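(* Let $\sigma = (\lambda_1, \lambda_2, \lambda_3, \lambda_4, \lambda_5)$ be a list of real numbers with $\lambda_1 \ge \lambda_2 \ge \lambda_3 \ge \lambda_4 \ge \lambda_5$. If some nonnegative symmetric $5 \times 5$ real matrix has spectrum $\sigma$, and $\sum_{i=1}^{5} \lambda_i \ge \frac{1}{2} \lambda_1$, then $\lambda_3 \le \sum_{i=1}^{5} \lambda_i$.
   Context: A matrix is nonnegative if all its entries are nonnegative real numbers. The spectrum of a matrix is the list of its eigenvalues counted with multiplicity. *)

theory Defs
  imports Complex_Main "Jordan_Normal_Form.Char_Poly"
begin

text \<open>For a square matrix: its complex eigenvalues, each repeated according to its algebraic
  multiplicity, i.e. its order as a root of the characteristic polynomial. For dimension \<open>n\<close> the
  multiset always has exactly \<open>n\<close> elements.\<close>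

definition spectrum_mset :: "real mat \<Rightarrow> complex multiset" where
  "spectrum_mset A = proots (char_poly (map_mat complex_of_real A))"

definition has_spectrum :: "real mat \<Rightarrow> real list \<Rightarrow> bool" where
  "has_spectrum A \<sigma> \<longleftrightarrow> spectrum_mset A = mset (map complex_of_real \<sigma>)"

definition nonneg_mat :: "real mat \<Rightarrow> bool" where
  "nonneg_mat A \<longleftrightarrow> (\<forall>i < dim_row A. \<forall>j < dim_col A. 0 \<le> A $$ (i, j))"

definition symmetric_mat :: "real mat \<Rightarrow> bool" where
  "symmetric_mat A \<longleftrightarrow> transpose_mat A = A"

end

theory Submission
  imports Defs
    "Jordan_Normal_Form.Schur_Decomposition"
    "HOL-Computational_Algebra.Fundamental_Theorem_Algebra"
    "HOL-Library.Periodic_Fun"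
begin

text \<open>Suppose the trace \<open>t\<close> satisfies \<open>l1 \<le> 2 t\<close> and \<open>t < l3\<close>; scale so that \<open>l3 = 1\<close>. On the orthogonal
  complement of the eigenvectors \<open>g, h\<close> for \<open>l4, l5\<close> the quadratic form of the matrix \<open>a\<close> dominates the
  identity, so every linear dependence among the plane vectors \<open>(g i, h i)\<close> gives an inequality
  between the entries of \<open>a\<close>. As \<open>l4, l5 < 0\<close>, the span of \<open>g, h\<close> contains no nonnegative vector, so the
  five plane vectors lie in no closed half plane and can be ordered cyclically. Put
  \<open>n i j = a i j / sqrt ((1 - a i i) * (1 - a j j))\<close>. Dependences of three vectors yield
  \<open>n k (k+2) \<ge> 1\<close>, and those of four vectors yield \<open>(n k (k+2))\<^sup>2 + (n (k+1) (k+3))\<^sup>2 \<ge> 4\<close>.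
  So the pentagram \<open>0, 2, 4, 1, 3\<close> carries large weights, and an explicit test vector shows that the
  largest eigenvalue of \<open>a\<close> is at least \<open>2\<close>, contradicting \<open>l1 \<le> 2 t < 2\<close>.\<close>

section \<open>Spectral theorem for real symmetric matrices\<close>

text \<open>Gram-Schmidt applied to a basis that starts with \<open>v\<close> leaves its first
  vector unchanged, and normalising only rescales it; \<open>c\<close> is that scaling factor. Over
  the reals, \<open>corthogonal\<close> is ordinary orthogonality because conjugation is the
  identity.\<close>

lemma orthonormal_basis_with_eigenvector:
  fixes v :: "real vec"
  assumes v: "v \<in> carrier_vec n" and v0: "v \<noteq> 0\<^sub>v n"
  obtains W c where "W \<in> carrier_mat n n" "W\<^sup>T * W = 1\<^sub>m n" "col W 0 = c \<cdot>\<^sub>v v"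
proof -
  interpret cof_vec_space n "TYPE(real)" .
  define b where "b = basis_completion v"
  define ws where "ws = gram_schmidt n b"
  from basis_completion[OF v v0, folded b_def]
  have span_b: "span (set b) = carrier_vec n" and dist_b: "distinct b"
    and indep: "\<not> lin_dep (set b)" and b: "set b \<subseteq> carrier_vec n" and hdb: "hd b = v"
    and len_b: "length b = n" by auto
  have n: "n \<noteq> 0"
  proof
    assume "n = 0"
    then have "v = 0\<^sub>v n" using v by (intro eq_vecI) auto
    then show False using v0 by simp
  qed
  from hdb len_b n obtain vs where bv: "b = v # vs" by (cases b) auto
  from gram_schmidt_result[OF b dist_b indep refl, folded ws_def]
  have ws: "set ws \<subseteq> carrier_vec n" "corthogonal ws" "length ws = n"
    by (auto simp: len_b)
  from gram_schmidt_hd[OF v, of vs, folded bv] have hdws: "hd ws = v" unfolding ws_def .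
  have wsi: "ws ! i \<in> carrier_vec n" if "i < n" for i using ws that by auto
  have conj: "conjugate w = w" for w :: "real vec" by (rule eq_vecI) auto
  have orth: "ws ! i \<bullet> ws ! j = 0 \<longleftrightarrow> i \<noteq> j" if "i < n" "j < n" for i j
    using corthogonalD[OF ws(2), of i j] that ws(3) by (simp add: conj)
  define s where "s i = 1 / sqrt (ws ! i \<bullet> ws ! i)" for i
  define W where "W = mat_of_cols n (map (\<lambda>i. s i \<cdot>\<^sub>v ws ! i) [0..<n])"
  have W: "W \<in> carrier_mat n n"
    unfolding W_def using mat_of_cols_carrier(1)[of n "map (\<lambda>i. s i \<cdot>\<^sub>v ws ! i) [0..<n]"] by simp
  have colW: "col W i = s i \<cdot>\<^sub>v ws ! i" if "i < n" for i
    unfolding W_def using that wsi[OF that] by (subst col_mat_of_cols) auto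
  have "W\<^sup>T * W = 1\<^sub>m n"
  proof (rule eq_matI)
    fix i j assume ij: "i < dim_row (1\<^sub>m n)" "j < dim_col (1\<^sub>m n)"
    have "(W\<^sup>T * W) $$ (i, j) = col W i \<bullet> col W j"
      using ij W by simp
    also have "\<dots> = s i * s j * (ws ! i \<bullet> ws ! j)"
      using ij wsi by (simp add: colW smult_scalar_prod_distrib[of _ n] scalar_prod_smult_distrib[of _ n])
    also have "\<dots> = (if i = j then 1 else 0)"
    proof (cases "i = j")
      case True
      have "0 \<le> ws ! i \<bullet> ws ! i" by (simp add: scalar_prod_def sum_nonneg)
      moreover have "ws ! i \<bullet> ws ! i \<noteq> 0" using orth[of i i] ij by simp
      ultimately show ?thesis using True by (simp add: s_def)
    next
      case False
      then show ?thesis using orth[of i j] ij by simp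
    qed
    finally show "(W\<^sup>T * W) $$ (i, j) = 1\<^sub>m n $$ (i, j)" using ij by simp
  qed (use W in auto)
  moreover have "col W 0 = s 0 \<cdot>\<^sub>v v"
    using colW[of 0] n hdws ws(3) by (cases ws) auto
  ultimately show thesis using that W by blast
qed

text \<open>Deflation: in an orthonormal basis whose first vector is an eigenvector for
  \<open>e\<close>, the symmetric matrix splits into the 1 by 1 block \<open>e\<close> and a
  symmetric block \<open>C\<close>. Cancelling the factor of \<open>e\<close> shows that the
  remaining list gives the characteristic polynomial of \<open>C\<close>. The diagonal keeps the
  order of the list, so eigenvectors can later be addressed by position.\<close>

lemma real_symmetric_diagonalisation:
  fixes A :: "real mat"
  assumes A: "A \<in> carrier_mat n n" and sym: "A\<^sup>T = A"
    and cp: "char_poly A = (\<Prod>e \<leftarrow> es. [:- e, 1:])"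
  shows "\<exists>P \<in> carrier_mat n n. P\<^sup>T * P = 1\<^sub>m n \<and>
    P\<^sup>T * A * P = mat n n (\<lambda>(i, j). if i = j then es ! i else 0)"
  using assms
proof (induction es arbitrary: n A)
  case Nil
  with degree_monic_char_poly[of A n] have "n = 0" by auto
  then show ?case by (intro bexI[of _ "1\<^sub>m 0"]) (auto intro!: eq_matI)
next
  case (Cons e es)
  note A = Cons.prems(1) and sym = Cons.prems(2) and cp = Cons.prems(3)
  have "degree (char_poly A) = Suc (length es)"
    unfolding cp degree_linear_factors by simp
  with degree_monic_char_poly[OF A] obtain m where n: "n = Suc m" by (cases n) auto
  have "eigenvalue A e" unfolding eigenvalue_root_char_poly[OF A] cp by simp
  then obtain v where "eigenvector A v e" unfolding eigenvalue_def by blast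
  then have v: "v \<in> carrier_vec n" "v \<noteq> 0\<^sub>v n" "A *\<^sub>v v = e \<cdot>\<^sub>v v"
    using A by (auto simp: eigenvector_def)
  obtain W c where W: "W \<in> carrier_mat n n" and WW: "W\<^sup>T * W = 1\<^sub>m n" and col0: "col W 0 = c \<cdot>\<^sub>v v"
    using orthonormal_basis_with_eigenvector[OF v(1,2)] .
  have WT: "W\<^sup>T \<in> carrier_mat n n" using W by simp
  have WW': "W * W\<^sup>T = 1\<^sub>m n" using mat_mult_left_right_inverse[OF WT W WW] .
  define B where "B = W\<^sup>T * A * W"
  have B: "B \<in> carrier_mat n n" using W A WT by (simp add: B_def)
  have Bsym: "B\<^sup>T = B"
    using A W WT sym unfolding B_def
    by (simp add: transpose_mult[of _ n n _ n] assoc_mult_mat[of _ n n _ n _ n])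
  have B0: "B $$ (i, 0) = (if i = 0 then e else 0)" if "i < n" for i
  proof -
    have "col (A * W) 0 = A *\<^sub>v col W 0" by (rule col_mult2[OF A W]) (use n in simp)
    also have "\<dots> = c \<cdot>\<^sub>v (A *\<^sub>v v)" unfolding col0 by (rule mult_mat_vec[OF A v(1)])
    also have "\<dots> = e \<cdot>\<^sub>v col W 0" unfolding v(3) col0 by (simp add: smult_smult_assoc mult.commute)
    finally have "B $$ (i, 0) = e * (col W i \<bullet> col W 0)"
      using that n A W WT unfolding B_def by (simp add: assoc_mult_mat[of _ n n _ n _ n])
    also have "col W i \<bullet> col W 0 = (W\<^sup>T * W) $$ (i, 0)" using that n W by simp
    finally show ?thesis unfolding WW using that n by simp
  qed
  have B0': "B $$ (0, i) = (if i = 0 then e else 0)" if "i < n" for i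
    using B0[OF that] that n B Bsym by (metis carrier_matD index_transpose_mat(1) zero_less_Suc)
  define C where "C = mat m m (\<lambda>(i, j). B $$ (Suc i, Suc j))"
  define E where "E = mat 1 1 (\<lambda>_. e)"
  have C: "C \<in> carrier_mat m m" and E: "E \<in> carrier_mat 1 1" by (auto simp: C_def E_def)
  have Bblock: "B = four_block_mat E (0\<^sub>m 1 m) (0\<^sub>m m 1) C"
    by (rule eq_matI) (use B n B0 B0' in \<open>auto simp: C_def E_def\<close>)
  have Csym: "C\<^sup>T = C"
  proof (rule eq_matI)
    fix i j assume "i < dim_row C" "j < dim_col C"
    then have ij: "i < m" "j < m" by (auto simp: C_def)
    have "B $$ (Suc j, Suc i) = B $$ (Suc i, Suc j)"
      using ij n B Bsym by (metis Suc_mono carrier_matD index_transpose_mat(1))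
    then show "C\<^sup>T $$ (i, j) = C $$ (i, j)" using ij by (simp add: C_def)
  qed (auto simp: C_def)
  have "similar_mat_wit B A W\<^sup>T W"
    by (rule similar_mat_witI[of _ _ n]) (use W WT A B WW WW' in \<open>auto simp: B_def\<close>)
  then have "char_poly B = char_poly A" by (intro char_poly_similar) (auto simp: similar_mat_def)
  moreover have "char_poly B = char_poly E * char_poly C"
    unfolding Bblock by (rule char_poly_four_block_zeros_col[OF E _ C]) simp
  moreover have "char_poly E = [:- e, 1:]"
    by (simp add: E_def char_poly_defs det_def sign_def)
  ultimately have "[:- e, 1:] * char_poly C = [:- e, 1:] * (\<Prod>e \<leftarrow> es. [:- e, 1:])"
    using cp by simp
  then have "char_poly C = (\<Prod>e \<leftarrow> es. [:- e, 1:])"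
    by (metis mult_cancel_left pCons_eq_0_iff zero_neq_one)
  from Cons.IH[OF C Csym this] obtain Q where Q: "Q \<in> carrier_mat m m" and QQ: "Q\<^sup>T * Q = 1\<^sub>m m"
    and QCQ: "Q\<^sup>T * C * Q = mat m m (\<lambda>(i, j). if i = j then es ! i else 0)" by blast
  define R where "R = four_block_mat (1\<^sub>m 1) (0\<^sub>m 1 m) (0\<^sub>m m 1) Q"
  have R: "R \<in> carrier_mat n n" unfolding R_def n using Q by auto
  have RT: "R\<^sup>T = four_block_mat (1\<^sub>m 1) (0\<^sub>m 1 m) (0\<^sub>m m 1) (Q\<^sup>T)"
    unfolding R_def using Q by (subst transpose_four_block_mat) auto
  have QT: "Q\<^sup>T \<in> carrier_mat m m" using Q by simp
  have "R\<^sup>T * R = four_block_mat (1\<^sub>m 1) (0\<^sub>m 1 m) (0\<^sub>m m 1) (Q\<^sup>T * Q)"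
    unfolding RT unfolding R_def using Q QT
    by (subst mult_four_block_mat[of _ 1 1 _ m _ m _ _ 1 _ m]) auto
  also have "\<dots> = 1\<^sub>m n" unfolding QQ n by (rule eq_matI) auto
  finally have RR: "R\<^sup>T * R = 1\<^sub>m n" .
  have "R\<^sup>T * B * R = four_block_mat E (0\<^sub>m 1 m) (0\<^sub>m m 1) (Q\<^sup>T * C * Q)"
    unfolding RT Bblock unfolding R_def using Q QT C E
    by (simp add: mult_four_block_mat[of _ 1 1 _ m _ m _ _ 1 _ m])
  also have "\<dots> = mat n n (\<lambda>(i, j). if i = j then (e # es) ! i else 0)"
    unfolding QCQ n by (rule eq_matI) (auto simp: E_def)
  finally have RBR: "R\<^sup>T * B * R = mat n n (\<lambda>(i, j). if i = j then (e # es) ! i else 0)" .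
  have T: "(W * R)\<^sup>T = R\<^sup>T * W\<^sup>T" by (rule transpose_mult[OF W R])
  have RTc: "R\<^sup>T \<in> carrier_mat n n" using R by simp
  have "(W * R)\<^sup>T * (W * R) = R\<^sup>T * (W\<^sup>T * W) * R"
    unfolding T using W R WT RTc by (simp add: assoc_mult_mat[of _ n n _ n _ n])
  then have "(W * R)\<^sup>T * (W * R) = 1\<^sub>m n" unfolding WW using RR RTc by simp
  moreover have "(W * R)\<^sup>T * A * (W * R) = R\<^sup>T * B * R"
    unfolding T B_def using W R WT RTc A by (simp add: assoc_mult_mat[of _ n n _ n _ n])
  ultimately show ?case using RBR W R by (intro bexI[of _ "W * R"]) auto
qed

text \<open>Over the complex numbers a monic polynomial is the product of the linear factors of its
  roots. Here all roots are real, and the embedding of real polynomials is injective, so the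
  factorisation descends to the reals.\<close>

lemma has_spectrum_char_poly:
  assumes A: "A \<in> carrier_mat n n" and "has_spectrum A es"
  shows "char_poly A = (\<Prod>e \<leftarrow> es. [:- e, 1:])"
proof -
  interpret inj_comm_ring_hom complex_of_real by unfold_locales auto
  interpret poly_hom: map_poly_inj_comm_ring_hom complex_of_real ..
  let ?p = "char_poly (map_mat complex_of_real A)"
  have "monic ?p" using A degree_monic_char_poly[of "map_mat complex_of_real A" n] by simp
  then have "?p = (\<Prod>x\<in>#proots ?p. [:-x, 1:])"
    using complex_poly_decompose_multiset[of ?p] by simp
  also have "\<dots> = (\<Prod>x \<leftarrow> map complex_of_real es. [:-x, 1:])"
    using assms(2) unfolding has_spectrum_def spectrum_mset_def
    by (metis mset_map prod_mset_prod_list)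
  also have "\<dots> = map_poly complex_of_real (\<Prod>e \<leftarrow> es. [:- e, 1:])"
    by (induction es) (simp_all add: poly_hom.hom_mult del: mult_pCons_left)
  finally have "?p = map_poly complex_of_real (\<Prod>e \<leftarrow> es. [:- e, 1:])" .
  moreover have "?p = map_poly complex_of_real (char_poly A)"
    by (rule of_real_hom.char_poly_hom[OF A])
  ultimately show ?thesis by (metis poly_hom.injectivity)
qed

lemma quadratic_form_expansion:
  fixes q :: "nat \<Rightarrow> nat \<Rightarrow> real"
  shows "(\<Sum>j<n. c j * (\<Sum>i<n. q j i * x i)\<^sup>2)
    = (\<Sum>i<n. \<Sum>k<n. (\<Sum>j<n. c j * q j i * q j k) * x i * x k)"
proof -
  have "(\<Sum>j<n. c j * (\<Sum>i<n. q j i * x i)\<^sup>2)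
      = (\<Sum>j<n. \<Sum>i<n. \<Sum>k<n. c j * q j i * q j k * x i * x k)"
    by (simp add: power2_eq_square sum_product sum_distrib_left mult_ac)
  also have "\<dots> = (\<Sum>i<n. \<Sum>j<n. \<Sum>k<n. c j * q j i * q j k * x i * x k)"
    by (rule sum.swap)
  also have "\<dots> = (\<Sum>i<n. \<Sum>k<n. \<Sum>j<n. c j * q j i * q j k * x i * x k)"
    by (intro sum.cong refl sum.swap)
  finally show ?thesis by (simp add: sum_distrib_right)
qed

lemma orthonormal_eigenvectors:
  fixes A :: "real mat"
  assumes A: "A \<in> carrier_mat n n" and sym: "A\<^sup>T = A"
    and cp: "char_poly A = (\<Prod>e \<leftarrow> es. [:- e, 1:])"
  obtains q :: "nat \<Rightarrow> nat \<Rightarrow> real" where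
    "\<And>j k. j < n \<Longrightarrow> k < n \<Longrightarrow> (\<Sum>i<n. q j i * q k i) = (if j = k then 1 else 0)"
    "\<And>x. (\<Sum>i<n. (x i)\<^sup>2) = (\<Sum>j<n. (\<Sum>i<n. q j i * x i)\<^sup>2)"
    "\<And>x. (\<Sum>i<n. \<Sum>k<n. A $$ (i, k) * x i * x k) = (\<Sum>j<n. es ! j * (\<Sum>i<n. q j i * x i)\<^sup>2)"
    "(\<Sum>i<n. A $$ (i, i)) = (\<Sum>j<n. es ! j)"
proof -
  define D where "D = mat n n (\<lambda>(i, j). if i = j then es ! i else 0)"
  obtain P where P: "P \<in> carrier_mat n n" and PP: "P\<^sup>T * P = 1\<^sub>m n" and PAP: "P\<^sup>T * A * P = D"
    using real_symmetric_diagonalisation[OF A sym cp] unfolding D_def by blast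
  have PT: "P\<^sup>T \<in> carrier_mat n n" and D: "D \<in> carrier_mat n n" using P by (auto simp: D_def)
  have PP': "P * P\<^sup>T = 1\<^sub>m n" using mat_mult_left_right_inverse[OF PT P PP] .
  have "P * D * P\<^sup>T = (P * P\<^sup>T) * A * (P * P\<^sup>T)"
    unfolding PAP[symmetric] using P PT A by (simp add: assoc_mult_mat[of _ n n _ n _ n])
  then have A_eq: "A = P * D * P\<^sup>T" unfolding PP' using A by simp
  \<comment> \<open>The eigenvectors are the columns of \<open>P\<close>, hence the exchanged
    indices. Orthonormality of \<open>q\<close> is read off from \<open>P\<^sup>T * P\<close>, while
    Parseval's identity needs \<open>P * P\<^sup>T\<close>.\<close>
  define q where "q j i = P $$ (i, j)" for j i
  have row: "(\<Sum>j<n. q j i * q j k) = (if i = k then 1 else 0)" if "i < n" "k < n" for i k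
  proof -
    have "(P * P\<^sup>T) $$ (i, k) = (\<Sum>j<n. q j i * q j k)"
      using that P by (simp add: scalar_prod_def q_def atLeast0LessThan)
    then show ?thesis unfolding PP' using that by simp
  qed
  have col: "(\<Sum>i<n. q j i * q k i) = (if j = k then 1 else 0)" if "j < n" "k < n" for j k
  proof -
    have "(P\<^sup>T * P) $$ (j, k) = (\<Sum>i<n. q j i * q k i)"
      using that P by (simp add: scalar_prod_def q_def atLeast0LessThan)
    then show ?thesis unfolding PP using that by simp
  qed
  have entry: "A $$ (i, k) = (\<Sum>j<n. es ! j * q j i * q j k)" if "i < n" "k < n" for i k
  proof -
    have PD: "(P * D) $$ (i, j) = q j i * es ! j" if "j < n" for j
    proof -
      have "(P * D) $$ (i, j) = (\<Sum>l<n. q l i * (if l = j then es ! l else 0))"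
        using that \<open>i < n\<close> P by (simp add: scalar_prod_def q_def D_def atLeast0LessThan)
      also have "\<dots> = (\<Sum>l<n. if l = j then q l i * es ! l else 0)"
        by (intro sum.cong) auto
      also have "\<dots> = q j i * es ! j" using that by simp
      finally show ?thesis .
    qed
    have "(M * P\<^sup>T) $$ (i, k) = (\<Sum>j<n. M $$ (i, j) * q j k)" if "M \<in> carrier_mat n n" for M
      using that \<open>i < n\<close> \<open>k < n\<close> P by (simp add: scalar_prod_def q_def atLeast0LessThan)
    from this[of "P * D"] have "A $$ (i, k) = (\<Sum>j<n. (P * D) $$ (i, j) * q j k)"
      unfolding A_eq[symmetric] using P D by simp
    then show ?thesis by (simp add: PD mult_ac)
  qed
  show thesis
  proof (rule that[OF col])
    fix x :: "nat \<Rightarrow> real"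
    have "(\<Sum>j<n. (\<Sum>i<n. q j i * x i)\<^sup>2) = (\<Sum>i<n. \<Sum>k<n. (\<Sum>j<n. q j i * q j k) * x i * x k)"
      using quadratic_form_expansion[of "\<lambda>_. 1"] by simp
    also have "\<dots> = (\<Sum>i<n. \<Sum>k<n. if i = k then x i * x k else 0)"
      by (intro sum.cong refl) (simp add: row)
    finally show "(\<Sum>i<n. (x i)\<^sup>2) = (\<Sum>j<n. (\<Sum>i<n. q j i * x i)\<^sup>2)"
      by (simp add: power2_eq_square)
    show "(\<Sum>i<n. \<Sum>k<n. A $$ (i, k) * x i * x k) = (\<Sum>j<n. es ! j * (\<Sum>i<n. q j i * x i)\<^sup>2)"
      unfolding quadratic_form_expansion by (intro sum.cong refl) (simp add: entry)
  next
    have "(\<Sum>i<n. A $$ (i, i)) = (\<Sum>i<n. \<Sum>j<n. es ! j * (q j i * q j i))"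
      by (intro sum.cong refl) (simp add: entry mult.assoc)
    also have "\<dots> = (\<Sum>j<n. es ! j * (\<Sum>i<n. q j i * q j i))"
      by (subst sum.swap) (simp add: sum_distrib_left)
    finally show "(\<Sum>i<n. A $$ (i, i)) = (\<Sum>j<n. es ! j)" by (simp add: col)
  qed
qed

section \<open>Weighted pentagons with loops\<close>

text \<open>(x + z - 1)^2 equals x^2 + z^2 - 1 + 2(x - 1)(z - 1), hence is at least 3.\<close>

lemma add_ge_of_sq:
  fixes x z :: real
  assumes "1 \<le> x" "1 \<le> z" "4 \<le> x\<^sup>2 + z\<^sup>2"
  shows "1 + sqrt 3 \<le> x + z"
proof -
  have "0 \<le> (x - 1) * (z - 1)" using assms by simp
  then have "3 \<le> (x + z - 1)\<^sup>2"
    using assms by (simp add: power2_eq_square algebra_simps)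
  then have "sqrt 3 \<le> \<bar>x + z - 1\<bar>"
    using real_sqrt_le_mono by fastforce
  then show ?thesis using assms by simp
qed

lemma sqrt3_bounds: "17/10 < sqrt (3::real)" "sqrt (3::real) < 9/5"
  by (rule real_less_rsqrt, simp add: power2_eq_square)
    (rule real_less_lsqrt; simp add: power2_eq_square)

text \<open>The test vector is constant in scaled coordinates, and the two sides are its loop and
  edge contributions. Convexity bounds 1/d by the chord over [1/2, 1], so the left side is at most
  12. Each edge lies in two of the five pairs from \<open>sq\<close>, so the right side is at least
  5(1 + sqrt 3), which exceeds 13.\<close>

lemma pentagon_small_loops:
  fixes e\<^sub>0 e\<^sub>1 e\<^sub>2 e\<^sub>3 e\<^sub>4 :: real
  assumes e: "1 \<le> e\<^sub>0" "1 \<le> e\<^sub>1" "1 \<le> e\<^sub>2" "1 \<le> e\<^sub>3" "1 \<le> e\<^sub>4"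
    and sq: "4 \<le> e\<^sub>0\<^sup>2 + e\<^sub>2\<^sup>2" "4 \<le> e\<^sub>1\<^sup>2 + e\<^sub>3\<^sup>2" "4 \<le> e\<^sub>2\<^sup>2 + e\<^sub>4\<^sup>2" "4 \<le> e\<^sub>3\<^sup>2 + e\<^sub>0\<^sup>2" "4 \<le> e\<^sub>4\<^sup>2 + e\<^sub>1\<^sup>2"
    and d: "1/2 \<le> d\<^sub>0" "1/2 \<le> d\<^sub>1" "1/2 \<le> d\<^sub>2" "1/2 \<le> d\<^sub>3" "1/2 \<le> d\<^sub>4"
    and le1: "d\<^sub>0 \<le> 1" "d\<^sub>1 \<le> 1" "d\<^sub>2 \<le> 1" "d\<^sub>3 \<le> 1" "d\<^sub>4 \<le> 1"
    and sum: "4 \<le> d\<^sub>0 + d\<^sub>1 + d\<^sub>2 + d\<^sub>3 + d\<^sub>4"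
  shows "(1 + 1/d\<^sub>0) + (1 + 1/d\<^sub>1) + (1 + 1/d\<^sub>2) + (1 + 1/d\<^sub>3) + (1 + 1/d\<^sub>4)
    \<le> 2 * (e\<^sub>0 + e\<^sub>1 + e\<^sub>2 + e\<^sub>3 + e\<^sub>4)"
proof -
  have chord: "1/u \<le> 3 - 2*u" if "1/2 \<le> u" "u \<le> 1" for u :: real
  proof -
    have "0 \<le> (2*u - 1) * (1 - u)" using that by simp
    then have "1 \<le> (3 - 2*u) * u" by (simp add: algebra_simps)
    then show ?thesis using that by (simp add: divide_le_eq)
  qed
  note pairs = add_ge_of_sq[OF e(1) e(3) sq(1)] add_ge_of_sq[OF e(2) e(4) sq(2)]
    add_ge_of_sq[OF e(3) e(5) sq(3)] add_ge_of_sq[OF e(4) e(1) sq(4)] add_ge_of_sq[OF e(5) e(2) sq(5)]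
  have "1/d\<^sub>0 + 1/d\<^sub>1 + 1/d\<^sub>2 + 1/d\<^sub>3 + 1/d\<^sub>4 \<le> 15 - 2 * (d\<^sub>0 + d\<^sub>1 + d\<^sub>2 + d\<^sub>3 + d\<^sub>4)"
    using chord[OF d(1) le1(1)] chord[OF d(2) le1(2)]
      chord[OF d(3) le1(3)] chord[OF d(4) le1(4)] chord[OF d(5) le1(5)] by argo
  moreover have "5 * (1 + sqrt 3) \<le> 2 * (e\<^sub>0 + e\<^sub>1 + e\<^sub>2 + e\<^sub>3 + e\<^sub>4)"
    using pairs by argo
  ultimately show ?thesis
    using sqrt3_bounds(1) sum by argo
qed

text \<open>With r = sqrt 3 and s = x + z, the lower bounds 1 + r - z for p and 1 + r - x for q make
  the sum at least (1 + r)s - s^2/2. This exceeds 2r by (2r - s)(s - 2)/2, which is nonnegative for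
  s up to 2r; beyond that, p and q being at least 1 suffices.\<close>

lemma cross_sum_ge:
  fixes p q x z :: real
  assumes "1 \<le> p" "1 \<le> q" "1 \<le> x" "1 \<le> z"
    and "4 \<le> p\<^sup>2 + z\<^sup>2" "4 \<le> q\<^sup>2 + x\<^sup>2" "4 \<le> x\<^sup>2 + z\<^sup>2"
  shows "12 \<le> (p * x + q * z)\<^sup>2"
proof -
  define r where "r = sqrt (3::real)"
  have r: "r * r = 3" "17/10 < r" "r < 9/5" using sqrt3_bounds by (auto simp: r_def)
  have pz: "1 + r \<le> p + z" and qx: "1 + r \<le> q + x" and xz: "1 + r \<le> x + z"
    using assms add_ge_of_sq by (auto simp: r_def)
  define s where "s = x + z"
  have ge: "2 * r \<le> p * x + q * z"
  proof (cases "2 * r \<le> s")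
    case True
    have "x \<le> p * x" "z \<le> q * z" using assms by simp_all
    then show ?thesis using True by (simp add: s_def)
  next
    case False
    have "(1 + r - z) * x \<le> p * x" "(1 + r - x) * z \<le> q * z"
      using assms pz qx by (auto intro!: mult_right_mono)
    then have 1: "(1 + r) * s - 2 * (x * z) \<le> p * x + q * z"
      by (simp add: s_def algebra_simps)
    have 2: "4 * (x * z) \<le> s * s"
      using zero_le_square[of "x - z"] by (simp add: s_def algebra_simps)
    have "0 \<le> (2 * r - s) * (s - 2)"
      using False xz r by (intro mult_nonneg_nonneg) (auto simp: s_def)
    then show ?thesis using 1 2 by (simp add: algebra_simps)
  qed
  have "(2 * r)\<^sup>2 \<le> (p * x + q * z)\<^sup>2"
    using ge r by (intro power_mono) auto
  then show ?thesis using r by (simp add: power2_eq_square)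
qed

text \<open>The coordinates \<open>(x/2, 1, 1, z/2)\<close> form the Perron vector in the extremal case
  \<open>x = z = sqrt 2\<close>, \<open>y = 1\<close>; given them, \<open>y\<^sub>0\<close> is the optimal fifth coordinate.\<close>
lemma pentagon_large_loop:
  fixes p x y z q :: real
  assumes e: "1 \<le> p" "1 \<le> x" "1 \<le> y" "1 \<le> z" "1 \<le> q"
    and sq: "4 \<le> p\<^sup>2 + z\<^sup>2" "4 \<le> q\<^sup>2 + x\<^sup>2" "4 \<le> x\<^sup>2 + z\<^sup>2"
    and d: "0 < d\<^sub>0" "d\<^sub>0 < 1/2"
    and le1: "d\<^sub>1 \<le> 1" "d\<^sub>2 \<le> 1" "d\<^sub>3 \<le> 1" "d\<^sub>4 \<le> 1"
    and sum: "4 \<le> d\<^sub>0 + d\<^sub>1 + d\<^sub>2 + d\<^sub>3 + d\<^sub>4"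
  defines "y\<^sub>0 \<equiv> d\<^sub>0 / (1 + d\<^sub>0) * ((p * x + q * z) / 2)"
  shows "(1 + 1/d\<^sub>0) * y\<^sub>0\<^sup>2 + (1 + 1/d\<^sub>1) * (x/2)\<^sup>2 + (1 + 1/d\<^sub>2) + (1 + 1/d\<^sub>3) + (1 + 1/d\<^sub>4) * (z/2)\<^sup>2
    \<le> 2 * (p * y\<^sub>0 * (x/2) + x * (x/2) + y + z * (z/2) + q * (z/2) * y\<^sub>0)"
proof -
  define S where "S = p * x + q * z"
  have dge: "1 - d\<^sub>0 \<le> d\<^sub>1" "1 - d\<^sub>0 \<le> d\<^sub>2" "1 - d\<^sub>0 \<le> d\<^sub>3" "1 - d\<^sub>0 \<le> d\<^sub>4"
    using sum le1 by linarith+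
  \<comment> \<open>This is the chord of the convex function 1/u over [1 - d, 1] with d =
    \<open>d\<^sub>0\<close>.\<close>
  have chord: "1/u \<le> 1 + (1 - u) / (1 - d\<^sub>0)" if "1 - d\<^sub>0 \<le> u" "u \<le> 1" for u
  proof -
    have u: "0 < u" using that d by linarith
    have "1/u - 1 = (1 - u) / u" using u by (simp add: field_simps)
    also have "\<dots> \<le> (1 - u) / (1 - d\<^sub>0)" using that d by (intro divide_left_mono) auto
    finally show ?thesis by simp
  qed
  \<comment> \<open>The numbers \<open>d\<^sub>1\<close> to \<open>d\<^sub>4\<close> together fall
    short of 4 by at most \<open>d\<^sub>0\<close>. \<open>M\<close> is the largest squared
    coordinate among these four vertices, so charging the whole shortfall at weight \<open>M\<close>
    covers the worst case.\<close>
  define M where "M = max 1 (max ((x/2)\<^sup>2) ((z/2)\<^sup>2))"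
  have M: "1 \<le> M" "(x/2)\<^sup>2 \<le> M" "(z/2)\<^sup>2 \<le> M" by (auto simp: M_def)
  have summand: "(1 + 1/u) * w \<le> 2 * w + (1 - u) / (1 - d\<^sub>0) * M"
    if "1 - d\<^sub>0 \<le> u" "u \<le> 1" "0 \<le> w" "w \<le> M" for u w
  proof -
    have "(1 + 1/u) * w \<le> (2 + (1 - u) / (1 - d\<^sub>0)) * w"
      using chord[OF that(1,2)] that(3) by (intro mult_right_mono) auto
    also have "\<dots> = 2 * w + (1 - u) / (1 - d\<^sub>0) * w" by (simp add: algebra_simps)
    also have "\<dots> \<le> 2 * w + (1 - u) / (1 - d\<^sub>0) * M"
      using that d by (intro add_left_mono mult_left_mono) auto
    finally show ?thesis .
  qed
  have "(1 - d\<^sub>1) / (1 - d\<^sub>0) * M + (1 - d\<^sub>2) / (1 - d\<^sub>0) * M + (1 - d\<^sub>3) / (1 - d\<^sub>0) * M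
      + (1 - d\<^sub>4) / (1 - d\<^sub>0) * M = (4 - d\<^sub>1 - d\<^sub>2 - d\<^sub>3 - d\<^sub>4) / (1 - d\<^sub>0) * M"
    by (simp add: add_divide_distrib diff_divide_distrib algebra_simps)
  also have "\<dots> \<le> d\<^sub>0 / (1 - d\<^sub>0) * M"
    using sum d M by (intro mult_right_mono divide_right_mono) auto
  finally have loss: "(1 + 1/d\<^sub>1) * (x/2)\<^sup>2 + (1 + 1/d\<^sub>2) + (1 + 1/d\<^sub>3) + (1 + 1/d\<^sub>4) * (z/2)\<^sup>2
      \<le> 2 * (x/2)\<^sup>2 + 4 + 2 * (z/2)\<^sup>2 + d\<^sub>0 / (1 - d\<^sub>0) * M"
    using summand[OF dge(1) le1(1) _ M(2)] summand[OF dge(2) le1(2) _ M(1)]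
      summand[OF dge(3) le1(3) _ M(1)] summand[OF dge(4) le1(4) _ M(3)] by simp
  have y0: "y\<^sub>0 = d\<^sub>0 * S / (2 * (1 + d\<^sub>0))" by (simp add: y\<^sub>0_def S_def)
  \<comment> \<open>The terms in \<open>y\<^sub>0\<close> form a concave quadratic; this is its
    maximum, attained at the chosen \<open>y\<^sub>0\<close>.\<close>
  have gain: "2 * (p * y\<^sub>0 * (x/2) + q * (z/2) * y\<^sub>0) - (1 + 1/d\<^sub>0) * y\<^sub>0\<^sup>2
      = d\<^sub>0 / (1 + d\<^sub>0) * S\<^sup>2 / 4"
  proof -
    have "2 * (p * y\<^sub>0 * (x/2) + q * (z/2) * y\<^sub>0) = S * y\<^sub>0" by (simp add: S_def algebra_simps)
    moreover have "(1 + 1/d\<^sub>0) * y\<^sub>0 = S / 2" 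
    proof -
      have ne: "1 + d\<^sub>0 \<noteq> 0" using d by linarith
      have "(1 + 1/d\<^sub>0) * y\<^sub>0 = ((1 + 1/d\<^sub>0) * d\<^sub>0) * S / ((1 + d\<^sub>0) * 2)"
        unfolding y0 by (simp add: mult.commute)
      also have "(1 + 1/d\<^sub>0) * d\<^sub>0 = 1 + d\<^sub>0" using d by (simp add: field_simps)
      also have "(1 + d\<^sub>0) * S / ((1 + d\<^sub>0) * 2) = S / 2"
        using ne by (rule nonzero_mult_divide_mult_cancel_left)
      finally show ?thesis .
    qed
    ultimately have "2 * (p * y\<^sub>0 * (x/2) + q * (z/2) * y\<^sub>0) - (1 + 1/d\<^sub>0) * y\<^sub>0\<^sup>2 = S * y\<^sub>0 - S / 2 * y\<^sub>0"
      by (simp add: power2_eq_square)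
    also have "\<dots> = S * y\<^sub>0 / 2" by simp
    finally show ?thesis unfolding y0 by (simp add: power2_eq_square algebra_simps)
  qed
  \<comment> \<open>The constants 2/3 and 2 are the values of 1/(1 + d) and 1/(1 - d) at the
    endpoint d = 1/2.\<close>
  have third: "2/3 * d\<^sub>0 \<le> d\<^sub>0 / (1 + d\<^sub>0)" and twice: "d\<^sub>0 / (1 - d\<^sub>0) \<le> 2 * d\<^sub>0"
    using d by (auto simp: field_simps)
  have main: "d\<^sub>0 / (1 - d\<^sub>0) * M \<le> d\<^sub>0 / (1 + d\<^sub>0) * S\<^sup>2 / 4 + (x\<^sup>2 + z\<^sup>2) / 2 + 2 * y - 4"
  proof -
    \<comment> \<open>If an outer coordinate x/2 is at least 1, the crude bound x + 1 for S already
      suffices. The variables are bound afresh so that the claim serves both ends of the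
      path.\<close>
    have big: "d\<^sub>0 / (1 - d\<^sub>0) * (x/2)\<^sup>2 \<le> d\<^sub>0 / (1 + d\<^sub>0) * S\<^sup>2 / 4 + (x\<^sup>2 + z\<^sup>2) / 2 + 2 * y - 4"
      if "2 \<le> x" "1 \<le> z" "x + z \<le> S" for x z :: real
    proof -
      have "(x + 1)\<^sup>2 \<le> S\<^sup>2" using that by (intro power_mono) auto
      then have 1: "2/3 * d\<^sub>0 * (x + 1)\<^sup>2 \<le> d\<^sub>0 / (1 + d\<^sub>0) * S\<^sup>2"
        using third d by (intro mult_mono) auto
      have 2: "d\<^sub>0 / (1 - d\<^sub>0) * (x/2)\<^sup>2 \<le> 2 * d\<^sub>0 * (x/2)\<^sup>2"
        using twice by (rule mult_right_mono) simp
      have "1 \<le> z\<^sup>2" using that by (simp add: one_le_power)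
      then have 3: "x\<^sup>2 / 2 - 3/2 \<le> (x\<^sup>2 + z\<^sup>2) / 2 + 2 * y - 4" using e(3) by argo
      have c: "2 * x \<le> x\<^sup>2" "4 \<le> x\<^sup>2"
        using that power_mono[of 2 x 2] by (auto simp: power2_eq_square)
      have "d\<^sub>0 * (2 * x\<^sup>2 - 2 * x - 1) \<le> 1/2 * (2 * x\<^sup>2 - 2 * x - 1)"
        using d that c by (intro mult_right_mono) linarith+
      also have "\<dots> \<le> 6 * (x\<^sup>2 / 2 - 3/2)"
        using c(2) that(1) by (simp add: algebra_simps)
      finally have 4: "2 * (d\<^sub>0 * x\<^sup>2) - 2 * (d\<^sub>0 * x) - d\<^sub>0 \<le> 6 * (x\<^sup>2 / 2 - 3/2)"
        by (simp add: algebra_simps)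
      have 5: "2/3 * (d\<^sub>0 * x\<^sup>2) + 4/3 * (d\<^sub>0 * x) + 2/3 * d\<^sub>0 \<le> d\<^sub>0 / (1 + d\<^sub>0) * S\<^sup>2"
      proof -
        have "2/3 * d\<^sub>0 * (x + 1)\<^sup>2 = 2/3 * (d\<^sub>0 * x\<^sup>2) + 4/3 * (d\<^sub>0 * x) + 2/3 * d\<^sub>0"
          by (simp add: power2_eq_square algebra_simps)
        then show ?thesis using 1 by argo
      qed
      have up: "d\<^sub>0 / (1 - d\<^sub>0) * (x/2)\<^sup>2 \<le> d\<^sub>0 * x\<^sup>2 / 2"
        using 2 by (simp add: power_divide)
      have lin: "D / 2 \<le> G / 4 + Q + 2 * y - 4"
        if "2 * D - 2 * E - d\<^sub>0 \<le> 6 * (T / 2 - 3/2)" "2/3 * D + 4/3 * E + 2/3 * d\<^sub>0 \<le> G"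
          "T / 2 - 3/2 \<le> Q + 2 * y - 4" for D E G Q T :: real
        using that by (simp add: field_simps)
      show ?thesis using up lin[OF 4 5 3] by (rule order_trans)
    qed
    have S: "x + z \<le> S" using e by (simp add: S_def add_mono)
    consider "M = (x/2)\<^sup>2" "2 \<le> x" | "M = (z/2)\<^sup>2" "2 \<le> z" | "M = 1"
    proof -
      have ge: "2 \<le> w" if "1 < (w/2)\<^sup>2" "1 \<le> w" for w :: real
        using that power_le_one[of "w/2" 2] by linarith
      have "M = 1 \<or> (M = (x/2)\<^sup>2 \<and> 1 < (x/2)\<^sup>2) \<or> (M = (z/2)\<^sup>2 \<and> 1 < (z/2)\<^sup>2)"
        unfolding M_def by linarith
      then show thesis using that ge e by blast
    qed
    then show ?thesis
    proof cases
      case 1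
      then show ?thesis using big[of x z] e S by simp
    next
      case 2
      then show ?thesis using big[of z x] e S by (simp add: add.commute)
    next
      case 3
      \<comment> \<open>For \<open>M = 1\<close> the gain is at least (2/3) * 12/4 = 2 times
        \<open>d\<^sub>0\<close>, which exactly pays for the bound on the loss. What remains is
        nonnegative because x^2 + z^2 is at least 4 and y is at least 1.\<close>
      have "12 \<le> S\<^sup>2" unfolding S_def by (rule cross_sum_ge) (use e sq in auto)
      then have 8: "2/3 * d\<^sub>0 * 12 \<le> d\<^sub>0 / (1 + d\<^sub>0) * S\<^sup>2"
        using third d by (intro mult_mono) auto
      have lin: "2 * D \<le> G / 4 + Q / 2 + 2 * y - 4" if "2/3 * D * 12 \<le> G" "4 \<le> Q" for D G Q :: real
        using that e(3) by linarith
      show ?thesis unfolding 3 mult_1_right using twice lin[OF 8 sq(3)] by (rule order_trans)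
    qed
  qed
  have lin: "A + t\<^sub>1 + t\<^sub>2 + t\<^sub>3 + t\<^sub>4 \<le> 2 * (P + X + y + Z + Q)"
    if "t\<^sub>1 + t\<^sub>2 + t\<^sub>3 + t\<^sub>4 \<le> U + 4 + V + L" "2 * (P + Q) - A = G" "L \<le> G + W + 2 * y - 4"
      "U + V + W = 2 * (X + Z)" for A t\<^sub>1 t\<^sub>2 t\<^sub>3 t\<^sub>4 P Q U V W X Z L G :: real
    using that by argo
  show ?thesis
    by (rule lin[OF loss gain main]) (simp add: power2_eq_square add_divide_distrib)
qed

section \<open>Cyclically ordered plane vectors\<close>

text \<open>Both products involving x are nonpositive and the diagonal term in x is at most x^2, so
  these only weaken the right side. What is left bounds (1 - \<alpha>)w^2 + (1 - \<gamma>)y^2 by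
  2ewy, and the arithmetic-geometric mean inequality finishes.\<close>

lemma edge_ge_of_form:
  fixes w x y :: real
  assumes form: "w\<^sup>2 + x\<^sup>2 + y\<^sup>2 \<le> \<alpha> * w\<^sup>2 + \<beta> * x\<^sup>2 + \<gamma> * y\<^sup>2 + 2 * (b * w * x + e * w * y + c * x * y)"
    and sgn: "0 < w" "0 < y" "x \<le> 0" and le1: "\<alpha> < 1" "\<beta> < 1" "\<gamma> < 1" and nonneg: "0 \<le> b" "0 \<le> c"
  shows "sqrt (1 - \<alpha>) * sqrt (1 - \<gamma>) \<le> e"
proof -
  define p q where "p = sqrt (1 - \<alpha>)" and "q = sqrt (1 - \<gamma>)"
  have pq: "p\<^sup>2 = 1 - \<alpha>" "q\<^sup>2 = 1 - \<gamma>" using le1 by (auto simp: p_def q_def)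
  have "b * w * x \<le> 0" "c * x * y \<le> 0" using sgn nonneg
    by (auto simp: mult_nonneg_nonpos mult_nonneg_nonpos2 mult.assoc mult_nonpos_nonneg)
  moreover have "\<beta> * x\<^sup>2 \<le> 1 * x\<^sup>2" using le1 by (intro mult_right_mono) auto
  ultimately have "p\<^sup>2 * w\<^sup>2 + q\<^sup>2 * y\<^sup>2 \<le> 2 * (e * w * y)"
    unfolding pq using form by (simp add: algebra_simps)
  moreover have "0 \<le> (p * w - q * y)\<^sup>2" by simp
  ultimately have "(p * q) * (w * y) \<le> e * (w * y)"
    by (simp add: power2_eq_square algebra_simps)
  then show ?thesis using sgn by (simp add: p_def q_def)
qed

text \<open>Since rz dominates pw, the terms in w and z on the left amount to at least 4 p^2 w^2.
  Completing the square in qx then eliminates x.\<close>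

lemma sq_ge_of_form:
  fixes w x z :: real
  assumes form: "p\<^sup>2 * w\<^sup>2 + q\<^sup>2 * x\<^sup>2 + r\<^sup>2 * z\<^sup>2 + 2 * (b * w * z) \<le> 2 * (e * w * x)"
    and b: "p * r \<le> b" and pos: "0 < p" "0 < q" "0 < r" "0 < w" and le: "p * w \<le> r * z"
  shows "4 \<le> (e / (p * q))\<^sup>2"
proof -
  have z: "0 \<le> z" using le pos by (metis less_eq_real_def mult_pos_pos mult_less_0_iff not_le order.trans)
  have 1: "p\<^sup>2 * w\<^sup>2 \<le> r\<^sup>2 * z\<^sup>2"
    using power_mono[OF le, of 2] pos by (simp add: power_mult_distrib)
  have "p\<^sup>2 * w\<^sup>2 = (p * w) * (p * w)" by (simp add: power2_eq_square)
  also have "\<dots> \<le> (p * w) * (r * z)" using le pos by (intro mult_left_mono) auto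
  also have "\<dots> = (p * r) * (w * z)" by simp
  also have "\<dots> \<le> b * (w * z)" using b z pos by (intro mult_right_mono) auto
  finally have "4 * (p\<^sup>2 * w\<^sup>2) + q\<^sup>2 * x\<^sup>2 \<le> 2 * (e * w * x)" using 1 form by (simp add: mult.assoc)
  moreover have "0 \<le> (q * x - e * w / q)\<^sup>2" by simp
  moreover have "(q * x - e * w / q)\<^sup>2 = q\<^sup>2 * x\<^sup>2 - 2 * (e * w * x) + (e / q)\<^sup>2 * w\<^sup>2"
    using pos by (simp add: power2_diff power_mult_distrib power_divide)
  ultimately have "4 * p\<^sup>2 * w\<^sup>2 \<le> (e / q)\<^sup>2 * w\<^sup>2" by linarith
  then have "4 * p\<^sup>2 \<le> (e / q)\<^sup>2" using pos by simp
  then show ?thesis using pos by (simp add: power_divide power_mult_distrib field_simps)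
qed

text \<open>Here \<open>g\<close> and \<open>h\<close> are the coordinates of five plane vectors listed in cyclic (angular) order,
  with indices read modulo 5: consecutive vectors are less than a half turn apart, and an arc
  from \<open>k\<close> to \<open>k+3\<close> exceeds a half turn as soon as one of the arcs \<open>k\<close> to \<open>k+2\<close> and \<open>k+1\<close> to \<open>k+3\<close> does.
  Four consecutive indices are an arbitrary 4-subset, so \<open>form\<close> covers every linear dependence
  in which some coefficient vanishes.\<close>

locale cyclic_config =
  fixes a :: "nat \<Rightarrow> nat \<Rightarrow> real" and g h :: "nat \<Rightarrow> real"
  assumes periodic: "a (i + 5) j = a i j" "g (i + 5) = g i" "h (i + 5) = h i"
    and sym: "a i j = a j i" and nonneg: "0 \<le> a i j" and diag: "a i i < 1"
    and form: "w * g k + x * g (k+1) + y * g (k+2) + z * g (k+3) = 0 \<Longrightarrow>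
      w * h k + x * h (k+1) + y * h (k+2) + z * h (k+3) = 0 \<Longrightarrow>
      w\<^sup>2 + x\<^sup>2 + y\<^sup>2 + z\<^sup>2 \<le> a k k * w\<^sup>2 + a (k+1) (k+1) * x\<^sup>2 + a (k+2) (k+2) * y\<^sup>2
        + a (k+3) (k+3) * z\<^sup>2 + 2 * (a k (k+1) * w * x + a k (k+2) * w * y + a k (k+3) * w * z
        + a (k+1) (k+2) * x * y + a (k+1) (k+3) * x * z + a (k+2) (k+3) * y * z)"
    and turn1: "0 < g k * h (k+1) - h k * g (k+1)"
    and turn2: "g k * h (k+2) - h k * g (k+2) < 0 \<Longrightarrow> g k * h (k+3) - h k * g (k+3) < 0"
    and turn3: "g (k+1) * h (k+3) - h (k+1) * g (k+3) < 0 \<Longrightarrow> g k * h (k+3) - h k * g (k+3) < 0"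
begin

definition s where "s i = sqrt (1 - a i i)"

definition n where "n i j = a i j / (s i * s j)"

text \<open>The planar cross product: its sign is that of the sine of the angle from vector
  \<open>i\<close> to vector \<open>j\<close>. By Cramer's rule its values supply the coefficients
  of the dependences below.\<close>

definition cr where "cr i j = g i * h j - h i * g j"

lemma s_pos: "0 < s i" and s_sq: "(s i)\<^sup>2 = 1 - a i i"
  using diag[of i] by (auto simp: s_def)

lemma periodic2: "a i (j + 5) = a i j"
  using periodic(1) sym by metis

lemma s_periodic: "s (i + 5) = s i"
  by (simp add: s_def periodic periodic2)

lemma cr_swap: "cr i j = - cr j i" by (simp add: cr_def)

lemma cr_pos: "j = k + 1 \<Longrightarrow> 0 < cr k j"
  using turn1[of k] by (simp add: cr_def)

text \<open>Three vectors within a half turn satisfy a dependence with signs \<open>+, -, +\<close>, in which the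
  outer edge is the only one with a positive contribution to the form. If \<open>k, k+1, k+2\<close> span more
  than a half turn, then \<open>k+2, k+3, k+5\<close> do not, and they have the same outer edge.\<close>
lemma edge_ge: "s k * s (k+2) \<le> a k (k+2)"
proof (cases "cr k (k+2) < 0")
  case False
  have "s k * s (k+2) \<le> a k (k+2)" unfolding s_def
  proof (rule edge_ge_of_form)
    show "(cr (k+1) (k+2))\<^sup>2 + (- cr k (k+2))\<^sup>2 + (cr k (k+1))\<^sup>2
      \<le> a k k * (cr (k+1) (k+2))\<^sup>2 + a (k+1) (k+1) * (- cr k (k+2))\<^sup>2 + a (k+2) (k+2) * (cr k (k+1))\<^sup>2
      + 2 * (a k (k+1) * cr (k+1) (k+2) * - cr k (k+2) + a k (k+2) * cr (k+1) (k+2) * cr k (k+1)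
        + a (k+1) (k+2) * - cr k (k+2) * cr k (k+1))"
    proof -
      have "cr (k+1) (k+2) * g k + - cr k (k+2) * g (k+1) + cr k (k+1) * g (k+2) + 0 * g (k+3) = 0"
        "cr (k+1) (k+2) * h k + - cr k (k+2) * h (k+1) + cr k (k+1) * h (k+2) + 0 * h (k+3) = 0"
        by (simp_all add: cr_def algebra_simps)
      from form[OF this] show ?thesis by simp
    qed
    show "0 < cr (k+1) (k+2)" "0 < cr k (k+1)"
      by (auto intro: cr_pos)
    show "- cr k (k+2) \<le> 0" using False by simp
  qed (auto intro: diag nonneg)
  then show ?thesis .
next
  case True
  have per: "cr i (k+5) = cr i k" for i by (simp add: cr_def periodic)
  have c0: "cr k (k+3) < 0" using turn2 True by (simp add: cr_def)
  have "s (k+2) * s k \<le> a (k+2) k" unfolding s_def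
  proof (rule edge_ge_of_form)
    show "(cr (k+3) k)\<^sup>2 + (- cr (k+2) k)\<^sup>2 + (cr (k+2) (k+3))\<^sup>2
      \<le> a (k+2) (k+2) * (cr (k+3) k)\<^sup>2 + a (k+3) (k+3) * (- cr (k+2) k)\<^sup>2 + a k k * (cr (k+2) (k+3))\<^sup>2
      + 2 * (a (k+2) (k+3) * cr (k+3) k * - cr (k+2) k + a (k+2) k * cr (k+3) k * cr (k+2) (k+3)
        + a (k+3) k * - cr (k+2) k * cr (k+2) (k+3))"
    proof -
      have shift: "k+2+1 = k+3" "k+2+2 = k+4" "k+2+3 = k+5" by simp_all
      note form' = form[of _ "k+2", unfolded shift periodic periodic2]
      \<comment> \<open>Cramer's dependence of the vectors \<open>k+2\<close>, \<open>k+3\<close>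
        and \<open>k\<close>, the last standing for \<open>k+5\<close>; the vector
        \<open>k+4\<close> gets coefficient 0.\<close>
      have "cr (k+3) k * g (k+2) + - cr (k+2) k * g (k+3) + 0 * g (k+4) + cr (k+2) (k+3) * g k = 0"
        "cr (k+3) k * h (k+2) + - cr (k+2) k * h (k+3) + 0 * h (k+4) + cr (k+2) (k+3) * h k = 0"
        by (simp_all add: cr_def algebra_simps)
      from form'[OF this] show ?thesis by simp
    qed
    show "0 < cr (k+3) k" "0 < cr (k+2) (k+3)" "- cr (k+2) k \<le> 0"
      using c0 True cr_pos[of "k+3" "k+2"] cr_swap[of k "k+2"] cr_swap[of k "k+3"]
      by simp_all
  qed (auto intro: diag nonneg)
  then show ?thesis by (simp add: sym mult.commute)
qed

lemma n_ge_1: "1 \<le> n k (k+2)"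
  using edge_ge[of k] s_pos[of k] s_pos[of "k+2"] by (simp add: n_def)

text \<open>With alternating signs, neighbouring vectors contribute nonpositive products, which are
  dropped. The outer pair also has opposite signs, but its term is kept on the left since it
  strengthens the bound; only the pairs two apart remain on the right.\<close>

lemma alternating_form:
  assumes "w * g k - x * g (k+1) + y * g (k+2) - z * g (k+3) = 0"
    "w * h k - x * h (k+1) + y * h (k+2) - z * h (k+3) = 0"
    and nn: "0 \<le> w" "0 \<le> x" "0 \<le> y" "0 \<le> z"
  shows "(s k)\<^sup>2 * w\<^sup>2 + (s (k+1))\<^sup>2 * x\<^sup>2 + (s (k+2))\<^sup>2 * y\<^sup>2 + (s (k+3))\<^sup>2 * z\<^sup>2 + 2 * (a k (k+3) * w * z)
    \<le> 2 * (a k (k+2) * w * y) + 2 * (a (k+1) (k+3) * z * x)"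
proof -
  have "0 \<le> a k (k+1) * w * x" "0 \<le> a (k+1) (k+2) * x * y" "0 \<le> a (k+2) (k+3) * y * z"
    using nn nonneg by simp_all
  then show ?thesis
    using form[of w k "- x" y "- z"] assms unfolding s_sq by (simp add: algebra_simps)
qed

text \<open>Among the dependences of the four vectors, prescribe the outer coefficients \<open>w\<close> and \<open>- z\<close> so that
  \<open>s k * w = s (k+3) * z = 1\<close>. If the signs then alternate, both edges together give the bound;
  otherwise a dependence with one inner coefficient zero already gives it for a single edge.\<close>
lemma n_sq_ge_4: "4 \<le> (n k (k+2))\<^sup>2 + (n (k+1) (k+3))\<^sup>2"
proof -
  \<comment> \<open>Modulo 5 the outer pair is itself a pentagram edge, from \<open>k+3\<close> to
    \<open>k+5\<close>.\<close>
  have mid: "s k * s (k+3) \<le> a k (k+3)"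
  proof -
    have "k + 3 + 2 = k + 5" by simp
    then show ?thesis
      using edge_ge[of "k+3", unfolded \<open>k + 3 + 2 = k + 5\<close> periodic2 s_periodic] sym[of k "k+3"]
      by (simp add: mult.commute)
  qed
  have c: "0 < cr k (k+1)" "0 < cr (k+1) (k+2)" "0 < cr (k+2) (k+3)"
    by (auto intro: cr_pos)
  define w z where "w = 1 / s k" and "z = 1 / s (k+3)"
  have wz: "0 < w" "0 < z" "s k * w = 1" "s (k+3) * z = 1"
    using s_pos[of k] s_pos[of "k+3"] by (simp_all add: w_def z_def)
  \<comment> \<open>Cramer's rule solves for the two inner coefficients once the outer ones are
    \<open>w\<close> and \<open>- z\<close>.\<close>
  define x y where "x = (w * cr k (k+2) + z * cr (k+2) (k+3)) / cr (k+1) (k+2)"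
    and "y = (w * cr k (k+1) + z * cr (k+1) (k+3)) / cr (k+1) (k+2)"
  consider "0 \<le> x" "0 \<le> y" | "x < 0" | "y < 0" by linarith
  then show ?thesis
  proof cases
    case 1
    have xy: "x * cr (k+1) (k+2) = w * cr k (k+2) + z * cr (k+2) (k+3)"
      "y * cr (k+1) (k+2) = w * cr k (k+1) + z * cr (k+1) (k+3)"
      using c by (simp_all add: x_def y_def)
    have "(w * g k - x * g (k+1) + y * g (k+2) - z * g (k+3)) * cr (k+1) (k+2)
      = w * g k * cr (k+1) (k+2) - (x * cr (k+1) (k+2)) * g (k+1) + (y * cr (k+1) (k+2)) * g (k+2)
        - z * g (k+3) * cr (k+1) (k+2)" by (simp add: algebra_simps)
    also have "\<dots> = 0" unfolding xy by (simp add: cr_def algebra_simps)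
    finally have G: "w * g k - x * g (k+1) + y * g (k+2) - z * g (k+3) = 0" using c by simp
    have "(w * h k - x * h (k+1) + y * h (k+2) - z * h (k+3)) * cr (k+1) (k+2)
      = w * h k * cr (k+1) (k+2) - (x * cr (k+1) (k+2)) * h (k+1) + (y * cr (k+1) (k+2)) * h (k+2)
        - z * h (k+3) * cr (k+1) (k+2)" by (simp add: algebra_simps)
    also have "\<dots> = 0" unfolding xy by (simp add: cr_def algebra_simps)
    finally have H: "w * h k - x * h (k+1) + y * h (k+2) - z * h (k+3) = 0" using c by simp
    have "1 \<le> a k (k+3) * w * z"
    proof -
      have "1 = (s k * s (k+3)) * (w * z)" using wz by (metis mult.assoc mult.left_commute mult_1)
      also have "\<dots> \<le> a k (k+3) * (w * z)" using mid wz by (intro mult_right_mono) auto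
      finally show ?thesis by simp
    qed
    moreover have "(s k)\<^sup>2 * w\<^sup>2 = 1" "(s (k+3))\<^sup>2 * z\<^sup>2 = 1"
      using wz by (simp_all flip: power_mult_distrib)
    \<comment> \<open>The outer vectors contribute 1 + 1 from the squares and at least 2 from their
      product, which makes the constant 4. Completing squares in the two scaled inner coefficients
      then gives the bound.\<close>
    ultimately have "4 + (s (k+1))\<^sup>2 * x\<^sup>2 + (s (k+2))\<^sup>2 * y\<^sup>2
      \<le> 2 * (a k (k+2) * w * y) + 2 * (a (k+1) (k+3) * z * x)"
      using alternating_form[OF G H] 1 wz by simp
    moreover have "2 * (a k (k+2) * w * y) = 2 * n k (k+2) * (s (k+2) * y)"
      using s_pos[of "k+2"] s_pos[of k] by (simp add: n_def w_def)
    moreover have "2 * (a (k+1) (k+3) * z * x) = 2 * n (k+1) (k+3) * (s (k+1) * x)"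
      using s_pos[of "k+1"] s_pos[of "k+3"] by (simp add: n_def z_def)
    moreover have "0 \<le> (n k (k+2) - s (k+2) * y)\<^sup>2" "0 \<le> (n (k+1) (k+3) - s (k+1) * x)\<^sup>2" by simp_all
    ultimately show ?thesis unfolding power2_diff power_mult_distrib by linarith
  next
    case 2
    then have lt: "w * cr k (k+2) + z * cr (k+2) (k+3) < 0"
      using c by (simp add: x_def divide_less_0_iff)
    then have c2: "cr k (k+2) < 0" using wz c
      by (metis add_nonneg_nonneg less_eq_real_def mult_nonneg_nonneg not_le)
    then have c3: "cr k (k+3) < 0" using turn2 by (simp add: cr_def)
    \<comment> \<open>Negativity of \<open>x\<close>, cleared of denominators, is the comparison of
      outer coefficients that \<open>sq_ge_of_form\<close> requires. It is applied to the dependence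
      of \<open>k\<close>, \<open>k+2\<close>, \<open>k+3\<close>, where the coefficient of
      \<open>k+1\<close> is zero.\<close>
    have le: "s k * cr (k+2) (k+3) \<le> s (k+3) * - cr k (k+2)"
    proof -
      have "s k * s (k+3) * (w * cr k (k+2) + z * cr (k+2) (k+3))
        = s (k+3) * cr k (k+2) * (s k * w) + s k * cr (k+2) (k+3) * (s (k+3) * z)"
        by (simp add: algebra_simps)
      moreover have "s k * s (k+3) * (w * cr k (k+2) + z * cr (k+2) (k+3)) \<le> 0"
        using lt s_pos[of k] s_pos[of "k+3"] by (intro mult_nonneg_nonpos) auto
      ultimately show ?thesis using wz by simp
    qed
    have "4 \<le> (a k (k+2) / (s k * s (k+2)))\<^sup>2"
    proof (rule sq_ge_of_form)
      show "(s k)\<^sup>2 * (cr (k+2) (k+3))\<^sup>2 + (s (k+2))\<^sup>2 * (- cr k (k+3))\<^sup>2 + (s (k+3))\<^sup>2 * (- cr k (k+2))\<^sup>2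
        + 2 * (a k (k+3) * cr (k+2) (k+3) * - cr k (k+2))
        \<le> 2 * (a k (k+2) * cr (k+2) (k+3) * - cr k (k+3))"
      proof -
        have "cr (k+2) (k+3) * g k - 0 * g (k+1) + - cr k (k+3) * g (k+2) - (- cr k (k+2)) * g (k+3) = 0"
          "cr (k+2) (k+3) * h k - 0 * h (k+1) + - cr k (k+3) * h (k+2) - (- cr k (k+2)) * h (k+3) = 0"
          by (simp_all add: cr_def algebra_simps)
        from alternating_form[OF this] show ?thesis using c c2 c3
          by (simp add: mult.commute mult.left_commute)
      qed
    qed (use mid le c s_pos in auto)
    then show ?thesis by (simp add: n_def add_increasing2)
  next
    \<comment> \<open>The mirror image of the previous case, with the roles of \<open>k\<close> and
      \<open>k+3\<close> exchanged and the coefficient of \<open>k+2\<close> zero.\<close>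
    case 3
    then have lt: "w * cr k (k+1) + z * cr (k+1) (k+3) < 0"
      using c by (simp add: y_def divide_less_0_iff)
    then have c2: "cr (k+1) (k+3) < 0" using wz c
      by (metis add_nonneg_nonneg less_eq_real_def mult_nonneg_nonneg not_le)
    then have c3: "cr k (k+3) < 0" using turn3 by (simp add: cr_def)
    have le: "s (k+3) * cr k (k+1) \<le> s k * - cr (k+1) (k+3)"
    proof -
      have "s k * s (k+3) * (w * cr k (k+1) + z * cr (k+1) (k+3))
        = s (k+3) * cr k (k+1) * (s k * w) + s k * cr (k+1) (k+3) * (s (k+3) * z)"
        by (simp add: algebra_simps)
      moreover have "s k * s (k+3) * (w * cr k (k+1) + z * cr (k+1) (k+3)) \<le> 0"
        using lt s_pos[of k] s_pos[of "k+3"] by (intro mult_nonneg_nonpos) auto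
      ultimately show ?thesis using wz by simp
    qed
    have "4 \<le> (a (k+1) (k+3) / (s (k+3) * s (k+1)))\<^sup>2"
    proof (rule sq_ge_of_form)
      show "(s (k+3))\<^sup>2 * (cr k (k+1))\<^sup>2 + (s (k+1))\<^sup>2 * (- cr k (k+3))\<^sup>2 + (s k)\<^sup>2 * (- cr (k+1) (k+3))\<^sup>2
        + 2 * (a k (k+3) * cr k (k+1) * - cr (k+1) (k+3))
        \<le> 2 * (a (k+1) (k+3) * cr k (k+1) * - cr k (k+3))"
      proof -
        have "- cr (k+1) (k+3) * g k - (- cr k (k+3)) * g (k+1) + 0 * g (k+2) - cr k (k+1) * g (k+3) = 0"
          "- cr (k+1) (k+3) * h k - (- cr k (k+3)) * h (k+1) + 0 * h (k+2) - cr k (k+1) * h (k+3) = 0"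
          by (simp_all add: cr_def algebra_simps)
        from alternating_form[OF this] show ?thesis using c c2 c3
          by (simp add: mult.commute mult.left_commute)
      qed
      show "s (k+3) * s k \<le> a k (k+3)" using mid by (simp add: mult.commute)
    qed (use le c s_pos in auto)
    then show ?thesis by (simp add: n_def add_increasing mult.commute)
  qed
qed

end

section \<open>Test vectors on the pentagram\<close>

context cyclic_config
begin

text \<open>The substitution v = y/s turns edge weights \<open>a\<close> into \<open>n\<close>. A
  vertex then costs (2 - a)/(1 - a) = 1 + 1/(1 - a) per unit of y^2, which is the loop weight of the
  pentagon lemmas.\<close>

lemma form_ge_weighted:
  assumes y: "0 \<le> y\<^sub>0" "0 \<le> y\<^sub>1" "0 \<le> y\<^sub>2" "0 \<le> y\<^sub>3" "0 \<le> y\<^sub>4"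
    and le: "(1 + 1/(1 - a i\<^sub>0 i\<^sub>0)) * y\<^sub>0\<^sup>2 + (1 + 1/(1 - a i\<^sub>1 i\<^sub>1)) * y\<^sub>1\<^sup>2 + (1 + 1/(1 - a i\<^sub>2 i\<^sub>2)) * y\<^sub>2\<^sup>2
      + (1 + 1/(1 - a i\<^sub>3 i\<^sub>3)) * y\<^sub>3\<^sup>2 + (1 + 1/(1 - a i\<^sub>4 i\<^sub>4)) * y\<^sub>4\<^sup>2
      \<le> 2 * (n i\<^sub>0 i\<^sub>1 * y\<^sub>0 * y\<^sub>1 + n i\<^sub>1 i\<^sub>2 * y\<^sub>1 * y\<^sub>2 + n i\<^sub>2 i\<^sub>3 * y\<^sub>2 * y\<^sub>3 + n i\<^sub>3 i\<^sub>4 * y\<^sub>3 * y\<^sub>4 + n i\<^sub>4 i\<^sub>0 * y\<^sub>4 * y\<^sub>0)"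
    and v: "v\<^sub>0 = y\<^sub>0 / s i\<^sub>0" "v\<^sub>1 = y\<^sub>1 / s i\<^sub>1" "v\<^sub>2 = y\<^sub>2 / s i\<^sub>2" "v\<^sub>3 = y\<^sub>3 / s i\<^sub>3" "v\<^sub>4 = y\<^sub>4 / s i\<^sub>4"
  shows "2 * (v\<^sub>0\<^sup>2 + v\<^sub>1\<^sup>2 + v\<^sub>2\<^sup>2 + v\<^sub>3\<^sup>2 + v\<^sub>4\<^sup>2)
    \<le> a i\<^sub>0 i\<^sub>0 * v\<^sub>0\<^sup>2 + a i\<^sub>1 i\<^sub>1 * v\<^sub>1\<^sup>2 + a i\<^sub>2 i\<^sub>2 * v\<^sub>2\<^sup>2 + a i\<^sub>3 i\<^sub>3 * v\<^sub>3\<^sup>2 + a i\<^sub>4 i\<^sub>4 * v\<^sub>4\<^sup>2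
      + 2 * (a i\<^sub>0 i\<^sub>1 * v\<^sub>0 * v\<^sub>1 + a i\<^sub>1 i\<^sub>2 * v\<^sub>1 * v\<^sub>2 + a i\<^sub>2 i\<^sub>3 * v\<^sub>2 * v\<^sub>3 + a i\<^sub>3 i\<^sub>4 * v\<^sub>3 * v\<^sub>4 + a i\<^sub>4 i\<^sub>0 * v\<^sub>4 * v\<^sub>0)"
proof -
  have loop: "2 * (y / s i)\<^sup>2 = a i i * (y / s i)\<^sup>2 + (1 + 1/(1 - a i i)) * y\<^sup>2" for y i
  proof -
    have "(2 - a i i) * (y / s i)\<^sup>2 = (2 - a i i) / (1 - a i i) * y\<^sup>2"
      by (simp add: power_divide s_sq)
    also have "(2 - a i i) / (1 - a i i) = 1 + 1/(1 - a i i)"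
      using diag[of i] by (simp add: field_simps)
    finally show ?thesis by (simp add: algebra_simps)
  qed
  have edge: "a i j * (y / s i) * (z / s j) = n i j * y * z" for i j y z
    by (simp add: n_def)
  show ?thesis
    unfolding v distrib_left[of 2] loop edge using le by (simp add: algebra_simps)
qed

text \<open>Along the pentagram, edges without a common vertex are the pairs controlled by
  \<open>n_sq_ge_4\<close>. A diagonal entry above 1/2 calls for \<open>pentagon_large_loop\<close>,
  started at that vertex; otherwise the constant scaled vector works. Positivity of
  \<open>v\<^sub>4\<close> records that the test vector is nonzero.\<close>

lemma exists_quotient_ge_2:
  assumes tr: "\<And>k. a k k + a (k+1) (k+1) + a (k+2) (k+2) + a (k+3) (k+3) + a (k+4) (k+4) < 1"
  obtains k v\<^sub>0 v\<^sub>1 v\<^sub>2 v\<^sub>3 v\<^sub>4 where "0 \<le> v\<^sub>0" "0 \<le> v\<^sub>1" "0 \<le> v\<^sub>2" "0 \<le> v\<^sub>3" "0 < v\<^sub>4"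
    "2 * (v\<^sub>0\<^sup>2 + v\<^sub>1\<^sup>2 + v\<^sub>2\<^sup>2 + v\<^sub>3\<^sup>2 + v\<^sub>4\<^sup>2)
    \<le> a k k * v\<^sub>0\<^sup>2 + a (k+1) (k+1) * v\<^sub>1\<^sup>2 + a (k+2) (k+2) * v\<^sub>2\<^sup>2 + a (k+3) (k+3) * v\<^sub>3\<^sup>2 + a (k+4) (k+4) * v\<^sub>4\<^sup>2
      + 2 * (a k (k+2) * v\<^sub>0 * v\<^sub>2 + a (k+2) (k+4) * v\<^sub>2 * v\<^sub>4 + a (k+4) (k+1) * v\<^sub>4 * v\<^sub>1
        + a (k+1) (k+3) * v\<^sub>1 * v\<^sub>3 + a (k+3) k * v\<^sub>3 * v\<^sub>0)"
proof -
  have n_per: "n i (j + 5) = n i j" "n (i + 5) j = n i j" for i j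
    by (simp_all add: n_def s_periodic periodic periodic2)
  have e: "1 \<le> n k (k+2)" "1 \<le> n (k+2) (k+4)" "1 \<le> n (k+4) (k+1)" "1 \<le> n (k+1) (k+3)" "1 \<le> n (k+3) k" for k
  proof -
    have sh: "k+2+2 = k+4" "k+4+2 = k+1+5" "k+1+2 = k+3" "k+3+2 = k+5" by simp_all
    show "1 \<le> n k (k+2)" "1 \<le> n (k+2) (k+4)" "1 \<le> n (k+4) (k+1)" "1 \<le> n (k+1) (k+3)" "1 \<le> n (k+3) k"
      using n_ge_1[of k] n_ge_1[of "k+2"] n_ge_1[of "k+4"] n_ge_1[of "k+1"] n_ge_1[of "k+3"]
      unfolding sh n_per by simp_all
  qed
  have sq: "4 \<le> (n k (k+2))\<^sup>2 + (n (k+1) (k+3))\<^sup>2" "4 \<le> (n (k+1) (k+3))\<^sup>2 + (n (k+2) (k+4))\<^sup>2"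
    "4 \<le> (n (k+2) (k+4))\<^sup>2 + (n (k+3) k)\<^sup>2" "4 \<le> (n (k+3) k)\<^sup>2 + (n (k+4) (k+1))\<^sup>2"
    "4 \<le> (n (k+4) (k+1))\<^sup>2 + (n k (k+2))\<^sup>2" for k
  proof -
    have sh: "k+1+1 = k+2" "k+1+2 = k+3" "k+1+3 = k+4" "k+2+1 = k+3" "k+2+2 = k+4" "k+2+3 = k+5"
      "k+3+1 = k+4" "k+3+2 = k+5" "k+3+3 = k+1+5" "k+4+1 = k+5" "k+4+2 = k+1+5" "k+4+3 = k+2+5" by simp_all
    show "4 \<le> (n k (k+2))\<^sup>2 + (n (k+1) (k+3))\<^sup>2" "4 \<le> (n (k+1) (k+3))\<^sup>2 + (n (k+2) (k+4))\<^sup>2"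
      "4 \<le> (n (k+2) (k+4))\<^sup>2 + (n (k+3) k)\<^sup>2" "4 \<le> (n (k+3) k)\<^sup>2 + (n (k+4) (k+1))\<^sup>2"
      "4 \<le> (n (k+4) (k+1))\<^sup>2 + (n k (k+2))\<^sup>2"
      using n_sq_ge_4[of k] n_sq_ge_4[of "k+1"] n_sq_ge_4[of "k+2"] n_sq_ge_4[of "k+3"] n_sq_ge_4[of "k+4"]
      unfolding sh n_per by simp_all
  qed
  have d: "1 - a i i \<le> 1" for i using nonneg[of i i] by simp
  have sum: "4 \<le> (1 - a k k) + (1 - a (k+2) (k+2)) + (1 - a (k+4) (k+4)) + (1 - a (k+1) (k+1)) + (1 - a (k+3) (k+3))" for k
    using tr[of k] by linarith
  show thesis
  proof (cases "\<exists>k. 1/2 < a k k")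
    case True
    then obtain k where k: "1/2 < a k k" by blast
    define y where "y = (1 - a k k) / (1 + (1 - a k k)) * ((n k (k+2) * n (k+2) (k+4) + n (k+3) k * n (k+1) (k+3)) / 2)"
    have y: "0 \<le> y" unfolding y_def using diag[of k] e[of k]
      by (intro mult_nonneg_nonneg divide_nonneg_nonneg add_nonneg_nonneg) auto
    have "(1 + 1/(1 - a k k)) * y\<^sup>2 + (1 + 1/(1 - a (k+2) (k+2))) * (n (k+2) (k+4) / 2)\<^sup>2
        + (1 + 1/(1 - a (k+4) (k+4))) + (1 + 1/(1 - a (k+1) (k+1))) + (1 + 1/(1 - a (k+3) (k+3))) * (n (k+1) (k+3) / 2)\<^sup>2
      \<le> 2 * (n k (k+2) * y * (n (k+2) (k+4) / 2) + n (k+2) (k+4) * (n (k+2) (k+4) / 2) + n (k+4) (k+1)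
        + n (k+1) (k+3) * (n (k+1) (k+3) / 2) + n (k+3) k * (n (k+1) (k+3) / 2) * y)"
      unfolding y_def
      by (rule pentagon_large_loop) (use e[of k] sq[of k] d sum[of k] k diag[of k] in \<open>auto simp: add.commute\<close>)
    then have "(1 + 1/(1 - a k k)) * y\<^sup>2 + (1 + 1/(1 - a (k+2) (k+2))) * (n (k+2) (k+4) / 2)\<^sup>2
        + (1 + 1/(1 - a (k+4) (k+4))) * 1\<^sup>2 + (1 + 1/(1 - a (k+1) (k+1))) * 1\<^sup>2 + (1 + 1/(1 - a (k+3) (k+3))) * (n (k+1) (k+3) / 2)\<^sup>2
      \<le> 2 * (n k (k+2) * y * (n (k+2) (k+4) / 2) + n (k+2) (k+4) * (n (k+2) (k+4) / 2) * 1 + n (k+4) (k+1) * 1 * 1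
        + n (k+1) (k+3) * 1 * (n (k+1) (k+3) / 2) + n (k+3) k * (n (k+1) (k+3) / 2) * y)"
      by simp
    from form_ge_weighted[OF _ _ _ _ _ this refl refl refl refl refl]
    show ?thesis
      by (intro that[where k = k and v\<^sub>0 = "y / s k" and v\<^sub>1 = "1 / s (k+1)" and v\<^sub>2 = "n (k+2) (k+4) / 2 / s (k+2)"
          and v\<^sub>3 = "n (k+1) (k+3) / 2 / s (k+3)" and v\<^sub>4 = "1 / s (k+4)"])
        (use y e[of k] s_pos in \<open>auto simp: less_imp_le algebra_simps\<close>)
  next
    case False
    have half: "1/2 \<le> 1 - a i i" for i
    proof -
      have "\<not> 1/2 < a i i" using False by blast
      then show ?thesis by simp
    qed
    have "(1 + 1/(1 - a 0 0)) + (1 + 1/(1 - a (0+2) (0+2))) + (1 + 1/(1 - a (0+4) (0+4)))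
        + (1 + 1/(1 - a (0+1) (0+1))) + (1 + 1/(1 - a (0+3) (0+3)))
      \<le> 2 * (n 0 (0+2) + n (0+2) (0+4) + n (0+4) (0+1) + n (0+1) (0+3) + n (0+3) 0)"
      by (rule pentagon_small_loops) (use e[of 0] sq[of 0] d sum[of 0] half in \<open>auto simp: add.commute\<close>)
    then have "(1 + 1/(1 - a 0 0)) * 1\<^sup>2 + (1 + 1/(1 - a (0+2) (0+2))) * 1\<^sup>2 + (1 + 1/(1 - a (0+4) (0+4))) * 1\<^sup>2
        + (1 + 1/(1 - a (0+1) (0+1))) * 1\<^sup>2 + (1 + 1/(1 - a (0+3) (0+3))) * 1\<^sup>2
      \<le> 2 * (n 0 (0+2) * 1 * 1 + n (0+2) (0+4) * 1 * 1 + n (0+4) (0+1) * 1 * 1 + n (0+1) (0+3) * 1 * 1 + n (0+3) 0 * 1 * 1)"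
      by simp
    from form_ge_weighted[OF _ _ _ _ _ this refl refl refl refl refl]
    show ?thesis
      by (intro that[where k = 0 and v\<^sub>0 = "1 / s 0" and v\<^sub>1 = "1 / s (0+1)" and v\<^sub>2 = "1 / s (0+2)"
          and v\<^sub>3 = "1 / s (0+3)" and v\<^sub>4 = "1 / s (0+4)"])
        (use s_pos in \<open>auto simp: less_imp_le algebra_simps\<close>)
  qed
qed

end

section \<open>Sorting plane vectors by angle\<close>

text \<open>Parallel vectors point in opposite directions, so the arguments are distinct and sorting
  by them gives the order. Signs of cross products become signs of sines of angle differences; over
  three steps the angle increases by less than a full turn, so a negative sine means more than a
  half turn.\<close>

lemma exists_cyclic_order:
  fixes g h :: "nat \<Rightarrow> real"
  assumes ne: "\<And>i. i < 5 \<Longrightarrow> g i \<noteq> 0 \<or> h i \<noteq> 0"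
    and not_parallel: "\<And>i j. i < 5 \<Longrightarrow> j < 5 \<Longrightarrow> i \<noteq> j \<Longrightarrow> g i * h j - h i * g j = 0 \<Longrightarrow> g i * g j + h i * h j < 0"
    and no_half_plane: "\<And>u v. (\<And>i. i < 5 \<Longrightarrow> 0 \<le> u * g i + v * h i) \<Longrightarrow> u = 0 \<and> v = 0"
  obtains c :: "nat \<Rightarrow> nat" where "\<And>k. c (k + 5) = c k" "\<And>k. bij_betw (\<lambda>j. c (k + j)) {..<5} {..<5}"
    "\<And>k. 0 < g (c k) * h (c (k+1)) - h (c k) * g (c (k+1))"
    "\<And>k. g (c k) * h (c (k+2)) - h (c k) * g (c (k+2)) < 0 \<Longrightarrow> g (c k) * h (c (k+3)) - h (c k) * g (c (k+3)) < 0"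
    "\<And>k. g (c (k+1)) * h (c (k+3)) - h (c (k+1)) * g (c (k+3)) < 0 \<Longrightarrow> g (c k) * h (c (k+3)) - h (c k) * g (c (k+3)) < 0"
proof -
  define \<theta> where "\<theta> i = Arg (Complex (g i) (h i))" for i
  define \<rho> where "\<rho> i = cmod (Complex (g i) (h i))" for i
  have \<rho>: "0 < \<rho> i" if "i < 5" for i using ne[OF that] by (auto simp: \<rho>_def complex_eq_iff)
  have polar: "g i = \<rho> i * cos (\<theta> i)" "h i = \<rho> i * sin (\<theta> i)" for i
    using Re_rcis[of "\<rho> i" "\<theta> i"] Im_rcis[of "\<rho> i" "\<theta> i"] rcis_cmod_Arg[of "Complex (g i) (h i)"]
    by (simp_all add: \<theta>_def \<rho>_def)
  have \<theta>: "- pi < \<theta> i" "\<theta> i \<le> pi" for i using Arg_bounded by (auto simp: \<theta>_def)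
  have inj: "i = j" if "i < 5" "j < 5" "\<theta> i = \<theta> j" for i j
  proof (rule ccontr)
    assume "i \<noteq> j"
    have "g i * h j - h i * g j = 0" unfolding polar that(3) by simp
    then have "g i * g j + h i * h j < 0" using not_parallel that \<open>i \<noteq> j\<close> by blast
    moreover have "g i * g j + h i * h j = \<rho> i * \<rho> j * ((sin (\<theta> j))\<^sup>2 + (cos (\<theta> j))\<^sup>2)"
      unfolding polar that(3) by (simp only: power2_eq_square distrib_left mult_ac add_ac)
    ultimately have "\<rho> i * \<rho> j < 0" by simp
    then show False using \<rho>[OF that(1)] \<rho>[OF that(2)] by (simp add: mult_less_0_iff)
  qed
  define xs where "xs = sort_key \<theta> [0..<5]"
  have xs: "length xs = 5" "set xs = {..<5}" "distinct xs" "sorted (map \<theta> xs)"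
    by (auto simp: xs_def)
  have xs_lt: "xs ! j < 5" if "j < 5" for j using xs nth_mem[of j xs] that by auto
  have xs_mono: "\<theta> (xs ! j) < \<theta> (xs ! Suc j)" if "Suc j < 5" for j
  proof -
    have "\<theta> (xs ! j) \<le> \<theta> (xs ! Suc j)"
      using sorted_nth_mono[OF xs(4), of j "Suc j"] that xs(1) by simp
    moreover have "xs ! j \<noteq> xs ! Suc j" using that xs by (simp add: nth_eq_iff_index_eq)
    ultimately show ?thesis using inj[of "xs ! j" "xs ! Suc j"] xs_lt that by fastforce
  qed
  define c where "c k = xs ! (k mod 5)" for k
  \<comment> \<open>The angle lifted to the real line, with a full turn added whenever the index
    passes a multiple of 5. It increases at the wrap as well because \<open>Arg\<close> takes values
    in (-pi, pi].\<close>
  define T where "T k = \<theta> (c k) + of_nat (k div 5) * (2 * pi)" for k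
  have c_lt: "c k < 5" for k using xs_lt by (simp add: c_def)
  have c_per: "c (k + 5) = c k" for k by (simp add: c_def)
  have T_per: "T (k + 5) = T k + 2 * pi" for k by (simp add: T_def c_per algebra_simps)
  have T_step: "T k < T (k + 1)" for k
  proof (cases "Suc (k mod 5) < 5")
    case True
    then have "Suc k mod 5 = Suc (k mod 5)" "Suc k div 5 = k div 5"
      by (auto simp: mod_Suc div_Suc)
    then show ?thesis using xs_mono[OF True] by (simp add: T_def c_def)
  next
    case False
    then have "Suc (k mod 5) = 5" using mod_less_divisor[of 5 k] by linarith
    then have "Suc k div 5 = Suc (k div 5)" by (simp add: div_Suc mod_Suc)
    then show ?thesis using \<theta>[of "c k"] \<theta>[of "c (k+1)"] by (simp add: T_def algebra_simps)
  qed
  have T_mono: "T i \<le> T j" if "i \<le> j" for i j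
    using lift_Suc_mono_le[of T, OF _ that] T_step by (simp add: less_imp_le)
  have bij: "bij_betw (\<lambda>j. c (k + j)) {..<5} {..<5}" for k
  proof -
    have "inj_on (\<lambda>j. c (k + j)) {..<5}"
    proof (rule inj_onI)
      fix i j assume ij: "i \<in> {..<5}" "j \<in> {..<5}" "c (k + i) = c (k + j)"
      then have eq: "(k + i) mod 5 = (k + j) mod 5"
        using xs by (simp add: c_def nth_eq_iff_index_eq)
      have le: "p = q" if "(k + p) mod 5 = (k + q) mod 5" "p \<le> q" "q < 5" for p q
      proof -
        have "5 dvd (k + q) - (k + p)" using that by (intro mod_eq_dvd_iff_nat[THEN iffD1]) auto
        then show ?thesis using that by (auto dest: dvd_imp_le)
      qed
      show "i = j"
      proof (cases "i \<le> j")
        case True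
        show ?thesis by (rule le[OF eq True]) (use ij in simp)
      next
        case False
        show ?thesis by (rule le[OF eq[symmetric], symmetric]) (use ij False in simp_all)
      qed
    qed
    moreover have "(\<lambda>j. c (k + j)) ` {..<5} \<subseteq> {..<5}" using c_lt by auto
    ultimately show ?thesis by (simp add: bij_betw_def endo_inj_surj)
  qed
  have cr: "g (c k) * h (c l) - h (c k) * g (c l) = \<rho> (c k) * \<rho> (c l) * sin (T l - T k)" for k l
  proof -
    have "cos (T j) = cos (\<theta> (c j))" "sin (T j) = sin (\<theta> (c j))" for j
      using cos.plus_of_nat[of "\<theta> (c j)" "j div 5"] sin.plus_of_nat[of "\<theta> (c j)" "j div 5"]
      by (simp_all add: T_def)
    then show ?thesis unfolding polar by (simp add: sin_diff algebra_simps)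
  qed
  have cr_neg: "g (c k) * h (c l) - h (c k) * g (c l) < 0 \<longleftrightarrow> sin (T l - T k) < 0" for k l
    unfolding cr using mult_pos_pos[OF \<rho>[OF c_lt[of k]] \<rho>[OF c_lt[of l]]]
    by (metis mult_less_cancel_left_pos mult_zero_right)
  \<comment> \<open>A gap of at least pi would put all five vectors in the closed half plane to the
    left of \<open>c (k + 1)\<close>, whose inner normal is that vector turned by a right
    angle.\<close>
  have gap: "T (k + 1) - T k < pi" for k
  proof (rule ccontr)
    assume "\<not> ?thesis"
    then have big: "pi \<le> T (k + 1) - T k" by simp
    define l where "l = k + 1"
    have "0 \<le> - h (c l) * g i + g (c l) * h i" if i: "i < 5" for i
    proof -
      obtain j where j: "j < 5" "i = c (l + j)"
        using bij_betw_imp_surj_on[OF bij[of l]] i by (metis imageE lessThan_iff)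
      have "T l \<le> T (l + j)" "T (l + j) \<le> T (l + 4)"
        using T_mono j(1) by simp_all
      moreover have "T (l + 4) = T k + 2 * pi" using T_per[of k] by (simp add: l_def add.commute)
      ultimately have "0 \<le> sin (T (l + j) - T l)"
        using big by (intro sin_ge_zero) (auto simp: l_def)
      then have "0 \<le> g (c l) * h i - h (c l) * g i"
        unfolding j cr using \<rho>[OF c_lt] by (simp add: less_imp_le)
      then show ?thesis by simp
    qed
    from no_half_plane[OF this] ne[OF c_lt[of l]] show False by simp
  qed
  have round: "T (k + 3) - T k < 2 * pi" for k
    using T_per[of k] T_step[of "k+3"] T_step[of "k+4"] by (simp add: add.commute)
  have sin_neg: "sin x < 0 \<longleftrightarrow> pi < x" if "0 \<le> x" "x < 2 * pi" for x
    using that sin_ge_zero[of x] sin_lt_zero[of x] by (meson linorder_not_less order.strict_trans1 not_le)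
  have steps: "T k < T (k+1)" "T (k+1) < T (k+2)" "T (k+2) < T (k+3)" for k
  proof -
    have "k + 1 + 1 = k + 2" "k + 2 + 1 = k + 3" by simp_all
    then show "T k < T (k+1)" "T (k+1) < T (k+2)" "T (k+2) < T (k+3)"
      using T_step[of k] T_step[of "k+1"] T_step[of "k+2"] by metis+
  qed
  show thesis
  proof (rule that[of c, OF c_per bij])
    fix k
    show "0 < g (c k) * h (c (k+1)) - h (c k) * g (c (k+1))"
      unfolding cr using \<rho>[OF c_lt] sin_gt_zero[of "T (k+1) - T k"] gap[of k] T_step[of k] by simp
    show "g (c k) * h (c (k+3)) - h (c k) * g (c (k+3)) < 0"
      if "g (c k) * h (c (k+2)) - h (c k) * g (c (k+2)) < 0"
      using that steps[of k] round[of k] unfolding cr_neg by (simp add: sin_neg)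
    show "g (c k) * h (c (k+3)) - h (c k) * g (c (k+3)) < 0"
      if "g (c (k+1)) * h (c (k+3)) - h (c (k+1)) * g (c (k+3)) < 0"
      using that steps[of k] round[of k] unfolding cr_neg by (simp add: sin_neg)
  qed
qed

section \<open>From quadratic form conditions to a cyclic configuration\<close>

text \<open>The normalised core: \<open>above\<close> encodes that the three largest eigenvalues are
  at least 1 and \<open>below\<close> that all are less than 2. The vectors \<open>g\<close> and
  \<open>h\<close> need not be eigenvectors here.\<close>

lemma no_plane_configuration:
  fixes a :: "nat \<Rightarrow> nat \<Rightarrow> real" and g h :: "nat \<Rightarrow> real"
  assumes sym: "\<And>i j. i < 5 \<Longrightarrow> j < 5 \<Longrightarrow> a i j = a j i"
    and nonneg: "\<And>i j. i < 5 \<Longrightarrow> j < 5 \<Longrightarrow> 0 \<le> a i j"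
    and trace: "(\<Sum>i<5. a i i) < 1"
    and above: "\<And>x. (\<Sum>i<5. x i * g i) = 0 \<Longrightarrow> (\<Sum>i<5. x i * h i) = 0 \<Longrightarrow>
      (\<Sum>i<5. (x i)\<^sup>2) \<le> (\<Sum>i<5. \<Sum>j<5. a i j * x i * x j)"
    and below: "\<And>x. \<exists>i<5. x i \<noteq> 0 \<Longrightarrow> (\<Sum>i<5. \<Sum>j<5. a i j * x i * x j) < 2 * (\<Sum>i<5. (x i)\<^sup>2)"
    and no_half_plane: "\<And>u v. (\<And>i. i < 5 \<Longrightarrow> 0 \<le> u * g i + v * h i) \<Longrightarrow> u = 0 \<and> v = 0"
  shows False
proof -
  have diag: "a i i < 1" if "i < 5" for i
  proof -
    have "a i i \<le> (\<Sum>i<5. a i i)" using that nonneg by (intro member_le_sum) auto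
    then show ?thesis using trace by simp
  qed
  \<comment> \<open>Dependences with two-element support rule out zero vectors and vectors in the
    same direction, as \<open>exists_cyclic_order\<close> requires.\<close>
  have two_points: "u\<^sup>2 + v\<^sup>2 \<le> a i i * u\<^sup>2 + a j j * v\<^sup>2 + 2 * (a i j * u * v)"
    if ij: "i < 5" "j < 5" "i \<noteq> j" and G: "u * g i + v * g j = 0" and H: "u * h i + v * h j = 0" for i j u v
  proof -
    define x where "x m = (if m = i then u else if m = j then v else 0)" for m
    have sum: "(\<Sum>m<5. F m) = F i + F j" if "\<And>m. m \<noteq> i \<Longrightarrow> m \<noteq> j \<Longrightarrow> F m = 0" for F :: "nat \<Rightarrow> real"
    proof -
      have "(\<Sum>m<5. F m) = (\<Sum>m\<in>{i, j}. F m)"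
        by (rule sum.mono_neutral_right) (use ij that in auto)
      then show ?thesis using ij by simp
    qed
    have x: "x i = u" "x j = v" "\<And>m. m \<noteq> i \<Longrightarrow> m \<noteq> j \<Longrightarrow> x m = 0" using ij by (auto simp: x_def)
    have "(\<Sum>m<5. x m * g m) = 0" "(\<Sum>m<5. x m * h m) = 0"
      using G H x by (simp_all add: sum)
    from above[OF this] show ?thesis
      using x sym[OF ij(1,2)] by (simp add: sum power2_eq_square algebra_simps)
  qed
  have ne: "g i \<noteq> 0 \<or> h i \<noteq> 0" if "i < 5" for i
  proof (rule ccontr)
    assume "\<not> ?thesis"
    then have "g i = 0" "h i = 0" by auto
    moreover obtain j :: nat where "j < 5" "i \<noteq> j" by (metis zero_less_numeral one_less_numeral_iff semiring_norm(77,79) zero_neq_one)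
    ultimately show False using two_points[of i j 1 0] diag[OF that] that by simp
  qed
  have np: "g i * g j + h i * h j < 0" if ij: "i < 5" "j < 5" "i \<noteq> j" and cross: "g i * h j - h i * g j = 0" for i j
  proof (rule ccontr)
    define D where "D = g i * g j + h i * h j"
    define N where "N = (g i)\<^sup>2 + (h i)\<^sup>2"
    assume "\<not> ?thesis"
    then have D: "0 \<le> D" by (simp add: D_def)
    have N: "0 < N" using ne[OF ij(1)] by (auto simp: N_def sum_power2_gt_zero_iff)
    \<comment> \<open>For parallel vectors this is a dependence with coefficients \<open>D\<close>
      and \<open>- N\<close>. If the directions agreed, the signs would be opposite and the cross
      term nonpositive, which diagonal entries below 1 do not permit.\<close>
    have "D * g i + - N * g j = h i * (g i * h j - h i * g j)" "D * h i + - N * h j = - g i * (g i * h j - h i * g j)"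
      by (simp_all add: D_def N_def power2_eq_square algebra_simps)
    then have "D\<^sup>2 + (- N)\<^sup>2 \<le> a i i * D\<^sup>2 + a j j * (- N)\<^sup>2 + 2 * (a i j * D * - N)"
      using cross by (intro two_points[OF ij]) auto
    moreover have "a i i * D\<^sup>2 \<le> 1 * D\<^sup>2" using diag[OF ij(1)] by (intro mult_right_mono) auto
    moreover have "a j j * (- N)\<^sup>2 < 1 * (- N)\<^sup>2" using diag[OF ij(2)] N by (intro mult_strict_right_mono) auto
    moreover have "0 \<le> a i j * D * N" using D N nonneg[OF ij(1,2)] by simp
    ultimately show False by simp
  qed
  obtain c :: "nat \<Rightarrow> nat" where per: "\<And>k. c (k + 5) = c k" and bij: "\<And>k. bij_betw (\<lambda>j. c (k + j)) {..<5} {..<5}"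
    and turn1: "\<And>k. 0 < g (c k) * h (c (k+1)) - h (c k) * g (c (k+1))"
    and turn2: "\<And>k. g (c k) * h (c (k+2)) - h (c k) * g (c (k+2)) < 0 \<Longrightarrow> g (c k) * h (c (k+3)) - h (c k) * g (c (k+3)) < 0"
    and turn3: "\<And>k. g (c (k+1)) * h (c (k+3)) - h (c (k+1)) * g (c (k+3)) < 0 \<Longrightarrow> g (c k) * h (c (k+3)) - h (c k) * g (c (k+3)) < 0"
    using exists_cyclic_order[of g h, OF ne np no_half_plane] by blast
  have c: "c k < 5" for k using bij_betwE[OF bij[of k]] by (metis add.right_neutral lessThan_iff zero_less_numeral)
  have sum5: "(\<Sum>m<5. F m) = F (c k) + F (c (k+1)) + F (c (k+2)) + F (c (k+3)) + F (c (k+4))" for F :: "nat \<Rightarrow> real" and k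
  proof -
    have "(\<Sum>m<5. F m) = (\<Sum>j<5. F (c (k + j)))"
      using sum.reindex_bij_betw[OF bij[of k], of F] by simp
    also have "\<dots> = F (c k) + F (c (k+1)) + F (c (k+2)) + F (c (k+3)) + F (c (k+4))"
      by (simp add: eval_nat_numeral lessThan_Suc add_ac)
    finally show ?thesis .
  qed
  have vec: "\<exists>x. x (c k) = v\<^sub>0 \<and> x (c (k+1)) = v\<^sub>1 \<and> x (c (k+2)) = v\<^sub>2 \<and> x (c (k+3)) = v\<^sub>3 \<and> x (c (k+4)) = v\<^sub>4"
    for k and v\<^sub>0 v\<^sub>1 v\<^sub>2 v\<^sub>3 v\<^sub>4 :: real
  proof -
    define x where "x m = [v\<^sub>0, v\<^sub>1, v\<^sub>2, v\<^sub>3, v\<^sub>4] ! inv_into {..<5} (\<lambda>j. c (k + j)) m" for m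
    have "x (c (k + j)) = [v\<^sub>0, v\<^sub>1, v\<^sub>2, v\<^sub>3, v\<^sub>4] ! j" if "j < 5" for j
      unfolding x_def using bij[of k] that
      by (subst inv_into_f_f[of "\<lambda>j. c (k + j)"]) (auto simp: bij_betw_def)
    from this[of 0] this[of 1] this[of 2] this[of 3] this[of 4] show ?thesis
      by (intro exI[of _ x]) simp
  qed
  have double: "(\<Sum>i<5. \<Sum>j<5. a i j * x i * x j) =
      a (c k) (c k) * v\<^sub>0\<^sup>2 + a (c (k+1)) (c (k+1)) * v\<^sub>1\<^sup>2 + a (c (k+2)) (c (k+2)) * v\<^sub>2\<^sup>2
      + a (c (k+3)) (c (k+3)) * v\<^sub>3\<^sup>2 + a (c (k+4)) (c (k+4)) * v\<^sub>4\<^sup>2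
      + 2 * (a (c k) (c (k+1)) * v\<^sub>0 * v\<^sub>1 + a (c k) (c (k+2)) * v\<^sub>0 * v\<^sub>2 + a (c k) (c (k+3)) * v\<^sub>0 * v\<^sub>3
        + a (c (k+4)) (c k) * v\<^sub>4 * v\<^sub>0 + a (c (k+1)) (c (k+2)) * v\<^sub>1 * v\<^sub>2 + a (c (k+1)) (c (k+3)) * v\<^sub>1 * v\<^sub>3
        + a (c (k+4)) (c (k+1)) * v\<^sub>4 * v\<^sub>1 + a (c (k+2)) (c (k+3)) * v\<^sub>2 * v\<^sub>3 + a (c (k+2)) (c (k+4)) * v\<^sub>2 * v\<^sub>4
        + a (c (k+3)) (c (k+4)) * v\<^sub>3 * v\<^sub>4)"
    if "x (c k) = v\<^sub>0" "x (c (k+1)) = v\<^sub>1" "x (c (k+2)) = v\<^sub>2" "x (c (k+3)) = v\<^sub>3" "x (c (k+4)) = v\<^sub>4"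
    for x k v\<^sub>0 v\<^sub>1 v\<^sub>2 v\<^sub>3 v\<^sub>4
  proof -
    note s = sym[OF c c]
    have s': "a (c (k+1)) (c k) = a (c k) (c (k+1))" "a (c (k+2)) (c k) = a (c k) (c (k+2))"
      "a (c (k+3)) (c k) = a (c k) (c (k+3))" "a (c k) (c (k+4)) = a (c (k+4)) (c k)"
      "a (c (k+2)) (c (k+1)) = a (c (k+1)) (c (k+2))" "a (c (k+3)) (c (k+1)) = a (c (k+1)) (c (k+3))"
      "a (c (k+1)) (c (k+4)) = a (c (k+4)) (c (k+1))" "a (c (k+3)) (c (k+2)) = a (c (k+2)) (c (k+3))"
      "a (c (k+4)) (c (k+2)) = a (c (k+2)) (c (k+4))" "a (c (k+4)) (c (k+3)) = a (c (k+3)) (c (k+4))"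
      by (rule s)+
    show ?thesis unfolding sum5[of _ k] that s' by (simp only: power2_eq_square algebra_simps)
  qed
  interpret cyc: cyclic_config "\<lambda>i j. a (c i) (c j)" "\<lambda>i. g (c i)" "\<lambda>i. h (c i)"
  proof
    fix i j k :: nat and w x y z :: real
    show "w\<^sup>2 + x\<^sup>2 + y\<^sup>2 + z\<^sup>2 \<le> a (c k) (c k) * w\<^sup>2 + a (c (k+1)) (c (k+1)) * x\<^sup>2 + a (c (k+2)) (c (k+2)) * y\<^sup>2
        + a (c (k+3)) (c (k+3)) * z\<^sup>2 + 2 * (a (c k) (c (k+1)) * w * x + a (c k) (c (k+2)) * w * y + a (c k) (c (k+3)) * w * z
        + a (c (k+1)) (c (k+2)) * x * y + a (c (k+1)) (c (k+3)) * x * z + a (c (k+2)) (c (k+3)) * y * z)"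
      if "w * g (c k) + x * g (c (k+1)) + y * g (c (k+2)) + z * g (c (k+3)) = 0"
        "w * h (c k) + x * h (c (k+1)) + y * h (c (k+2)) + z * h (c (k+3)) = 0"
    proof -
      \<comment> \<open>A dependence of four vectors is one of all five that vanishes at the
        remaining index \<open>c (k+4)\<close>.\<close>
      obtain f where f: "f (c k) = w" "f (c (k+1)) = x" "f (c (k+2)) = y" "f (c (k+3)) = z" "f (c (k+4)) = 0"
        using vec[of k w x y z 0] by blast
      have "(\<Sum>i<5. f i * g i) = 0" "(\<Sum>i<5. f i * h i) = 0" "(\<Sum>i<5. (f i)\<^sup>2) = w\<^sup>2 + x\<^sup>2 + y\<^sup>2 + z\<^sup>2"
        unfolding sum5[of _ k] f using that by simp_all
      then show ?thesis using above[of f] unfolding double[OF f] by simp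
    qed
  qed (use per c sym nonneg diag turn1 turn2 turn3 in auto)
  have tr: "a (c k) (c k) + a (c (k+1)) (c (k+1)) + a (c (k+2)) (c (k+2)) + a (c (k+3)) (c (k+3)) + a (c (k+4)) (c (k+4)) < 1" for k
    using trace unfolding sum5[of _ k] .
  obtain k v\<^sub>0 v\<^sub>1 v\<^sub>2 v\<^sub>3 v\<^sub>4
    where v: "0 \<le> v\<^sub>0" "0 \<le> v\<^sub>1" "0 \<le> v\<^sub>2" "0 \<le> v\<^sub>3" "0 < v\<^sub>4"
      and ge: "2 * (v\<^sub>0\<^sup>2 + v\<^sub>1\<^sup>2 + v\<^sub>2\<^sup>2 + v\<^sub>3\<^sup>2 + v\<^sub>4\<^sup>2)
      \<le> a (c k) (c k) * v\<^sub>0\<^sup>2 + a (c (k+1)) (c (k+1)) * v\<^sub>1\<^sup>2 + a (c (k+2)) (c (k+2)) * v\<^sub>2\<^sup>2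
        + a (c (k+3)) (c (k+3)) * v\<^sub>3\<^sup>2 + a (c (k+4)) (c (k+4)) * v\<^sub>4\<^sup>2
        + 2 * (a (c k) (c (k+2)) * v\<^sub>0 * v\<^sub>2 + a (c (k+2)) (c (k+4)) * v\<^sub>2 * v\<^sub>4 + a (c (k+4)) (c (k+1)) * v\<^sub>4 * v\<^sub>1
        + a (c (k+1)) (c (k+3)) * v\<^sub>1 * v\<^sub>3 + a (c (k+3)) (c k) * v\<^sub>3 * v\<^sub>0)"
    by (rule cyc.exists_quotient_ge_2[OF tr]) (rule that)
  obtain f where f: "f (c k) = v\<^sub>0" "f (c (k+1)) = v\<^sub>1" "f (c (k+2)) = v\<^sub>2" "f (c (k+3)) = v\<^sub>3" "f (c (k+4)) = v\<^sub>4"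
    using vec[of k v\<^sub>0 v\<^sub>1 v\<^sub>2 v\<^sub>3 v\<^sub>4] by blast
  have "\<exists>i<5. f i \<noteq> 0" using f(5) v(5) c by (intro exI[of _ "c (k+4)"]) auto
  from below[OF this] have "a (c k) (c k) * v\<^sub>0\<^sup>2 + a (c (k+1)) (c (k+1)) * v\<^sub>1\<^sup>2 + a (c (k+2)) (c (k+2)) * v\<^sub>2\<^sup>2
      + a (c (k+3)) (c (k+3)) * v\<^sub>3\<^sup>2 + a (c (k+4)) (c (k+4)) * v\<^sub>4\<^sup>2
      + 2 * (a (c k) (c (k+1)) * v\<^sub>0 * v\<^sub>1 + a (c k) (c (k+2)) * v\<^sub>0 * v\<^sub>2 + a (c k) (c (k+3)) * v\<^sub>0 * v\<^sub>3
        + a (c (k+4)) (c k) * v\<^sub>4 * v\<^sub>0 + a (c (k+1)) (c (k+2)) * v\<^sub>1 * v\<^sub>2 + a (c (k+1)) (c (k+3)) * v\<^sub>1 * v\<^sub>3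
        + a (c (k+4)) (c (k+1)) * v\<^sub>4 * v\<^sub>1 + a (c (k+2)) (c (k+3)) * v\<^sub>2 * v\<^sub>3 + a (c (k+2)) (c (k+4)) * v\<^sub>2 * v\<^sub>4
        + a (c (k+3)) (c (k+4)) * v\<^sub>3 * v\<^sub>4) < 2 * (v\<^sub>0\<^sup>2 + v\<^sub>1\<^sup>2 + v\<^sub>2\<^sup>2 + v\<^sub>3\<^sup>2 + v\<^sub>4\<^sup>2)"
    unfolding double[OF f] unfolding sum5[of _ k] f .
  \<comment> \<open>The test vector counts only pentagram edges; the five sides of the pentagon add
    nonnegative terms to the full form.\<close>
  moreover have "0 \<le> a (c k) (c (k+1)) * v\<^sub>0 * v\<^sub>1" "0 \<le> a (c (k+4)) (c k) * v\<^sub>4 * v\<^sub>0"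
    "0 \<le> a (c (k+1)) (c (k+2)) * v\<^sub>1 * v\<^sub>2" "0 \<le> a (c (k+2)) (c (k+3)) * v\<^sub>2 * v\<^sub>3"
    "0 \<le> a (c (k+3)) (c (k+4)) * v\<^sub>3 * v\<^sub>4" "a (c (k+3)) (c k) * v\<^sub>3 * v\<^sub>0 = a (c k) (c (k+3)) * v\<^sub>0 * v\<^sub>3"
    using v nonneg[OF c c] sym[OF c c, of k "k+3"] by simp_all
  ultimately show False using ge by argo
qed

section \<open>The bound on the third eigenvalue\<close>

theorem theorem3:
  fixes l1 l2 l3 l4 l5 :: real
  assumes "l1 \<ge> l2" and "l2 \<ge> l3" and "l3 \<ge> l4" and "l4 \<ge> l5"
    and "\<exists>A \<in> carrier_mat 5 5. nonneg_mat A \<and> symmetric_mat A \<and> has_spectrum A [l1, l2, l3, l4, l5]"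
    and "l1 + l2 + l3 + l4 + l5 \<ge> 1 / 2 * l1"
  shows "l3 \<le> l1 + l2 + l3 + l4 + l5"
proof (rule ccontr)
  assume "\<not> ?thesis"
  then have lt: "l1 + l2 + l3 + l4 + l5 < l3" by simp
  obtain A where A: "A \<in> carrier_mat 5 5" "nonneg_mat A" "symmetric_mat A"
    and spec: "has_spectrum A [l1, l2, l3, l4, l5]" using assms(5) by blast
  have sums: "(\<Sum>j<5. F j) = F 0 + F 1 + F 2 + F 3 + F 4" for F :: "nat \<Rightarrow> real"
    by (simp add: eval_nat_numeral lessThan_Suc add_ac)
  obtain q :: "nat \<Rightarrow> nat \<Rightarrow> real" where
    orth: "\<And>j k. j < 5 \<Longrightarrow> k < 5 \<Longrightarrow> (\<Sum>i<5. q j i * q k i) = (if j = k then 1 else 0)"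
    and norm: "\<And>x. (\<Sum>i<5. (x i)\<^sup>2) = (\<Sum>j<5. (\<Sum>i<5. q j i * x i)\<^sup>2)"
    and quad: "\<And>x. (\<Sum>i<5. \<Sum>k<5. A $$ (i, k) * x i * x k)
      = (\<Sum>j<5. [l1, l2, l3, l4, l5] ! j * (\<Sum>i<5. q j i * x i)\<^sup>2)"
    and trace: "(\<Sum>i<5. A $$ (i, i)) = (\<Sum>j<5. [l1, l2, l3, l4, l5] ! j)"
    by (rule orthonormal_eigenvectors[OF A(1) A(3)[unfolded symmetric_mat_def] has_spectrum_char_poly[OF A(1) spec]])
      (rule that)
  have nonneg: "0 \<le> A $$ (i, j)" if "i < 5" "j < 5" for i j
    using A(1,2) that by (auto simp: nonneg_mat_def)
  have tr: "(\<Sum>i<5. A $$ (i, i)) = l1 + l2 + l3 + l4 + l5" unfolding trace by (simp add: sums)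
  have "0 \<le> (\<Sum>i<5. A $$ (i, i))" using nonneg by (intro sum_nonneg) auto
  then have l3: "0 < l3" using tr lt by simp
  have upper: "(\<Sum>i<5. \<Sum>k<5. A $$ (i, k) * x i * x k) \<le> l1 * (\<Sum>i<5. (x i)\<^sup>2)" for x
  proof -
    have "[l1, l2, l3, l4, l5] ! j \<le> l1" if "j < 5" for j
      using that assms(1-4) by (auto simp: eval_nat_numeral less_Suc_eq)
    then show ?thesis unfolding quad norm[of x] sum_distrib_left
      by (intro sum_mono mult_right_mono) auto
  qed
  have form: "(\<Sum>i<5. \<Sum>k<5. A $$ (i, k) * x i * x k)
      = l1 * (\<Sum>i<5. q 0 i * x i)\<^sup>2 + l2 * (\<Sum>i<5. q 1 i * x i)\<^sup>2 + l3 * (\<Sum>i<5. q 2 i * x i)\<^sup>2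
        + l4 * (\<Sum>i<5. q 3 i * x i)\<^sup>2 + l5 * (\<Sum>i<5. q 4 i * x i)\<^sup>2" for x
    unfolding quad by (subst sums) simp
  \<comment> \<open>The Perron-Frobenius estimate: passing to absolute values in the eigenvector for
    \<open>l5\<close> cannot decrease the absolute value of the form.\<close>
  have "- l5 \<le> l1"
  proof -
    have "- l5 = - (\<Sum>i<5. \<Sum>k<5. A $$ (i, k) * q 4 i * q 4 k)"
      unfolding form by (simp add: orth)
    also have "\<dots> \<le> (\<Sum>i<5. \<Sum>k<5. A $$ (i, k) * \<bar>q 4 i\<bar> * \<bar>q 4 k\<bar>)"
      unfolding sum_negf[symmetric]
    proof (intro sum_mono)
      fix i k :: nat assume "i \<in> {..<5}" "k \<in> {..<5}"
      then have "- (q 4 i * q 4 k) * A $$ (i, k) \<le> \<bar>q 4 i * q 4 k\<bar> * A $$ (i, k)"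
        by (intro mult_right_mono nonneg) auto
      then show "- (A $$ (i, k) * q 4 i * q 4 k) \<le> A $$ (i, k) * \<bar>q 4 i\<bar> * \<bar>q 4 k\<bar>"
        by (simp add: abs_mult mult_ac)
    qed
    also have "\<dots> \<le> l1 * (\<Sum>i<5. \<bar>q 4 i\<bar>\<^sup>2)" by (rule upper)
    also have "(\<Sum>i<5. \<bar>q 4 i\<bar>\<^sup>2) = 1" using orth[of 4 4] by (simp add: power2_eq_square)
    finally show ?thesis by simp
  qed
  \<comment> \<open>The assumed inequality says l1 + l2 + l4 + l5 < 0; with -l5 at most l1 this
    gives l4 < -l2 < 0.\<close>
  then have l4: "l4 < 0" and l5: "l5 < 0" using lt l3 assms(2,4) by linarith+
  show False
  proof (rule no_plane_configuration[of "\<lambda>i j. A $$ (i, j) / l3" "q 3" "q 4"])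
    show "A $$ (i, j) / l3 = A $$ (j, i) / l3" if "i < 5" "j < 5" for i j
      using A(1,3) that unfolding symmetric_mat_def by (metis carrier_matD index_transpose_mat(1))
    show "0 \<le> A $$ (i, j) / l3" if "i < 5" "j < 5" for i j using nonneg[OF that] l3 by simp
    show "(\<Sum>i<5. A $$ (i, i) / l3) < 1"
      using lt l3 tr by (simp flip: sum_divide_distrib)
    fix x :: "nat \<Rightarrow> real"
    have scale: "(\<Sum>i<5. \<Sum>j<5. A $$ (i, j) / l3 * x i * x j) = (\<Sum>i<5. \<Sum>j<5. A $$ (i, j) * x i * x j) / l3"
      by (simp add: sum_divide_distrib)
    show "(\<Sum>i<5. (x i)\<^sup>2) \<le> (\<Sum>i<5. \<Sum>j<5. A $$ (i, j) / l3 * x i * x j)"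
      if "(\<Sum>i<5. x i * q 3 i) = 0" "(\<Sum>i<5. x i * q 4 i) = 0"
    proof -
      have z: "(\<Sum>i<5. q 3 i * x i) = 0" "(\<Sum>i<5. q 4 i * x i) = 0" using that by (simp_all add: mult.commute)
      have "l3 * (\<Sum>i<5. q 0 i * x i)\<^sup>2 \<le> l1 * (\<Sum>i<5. q 0 i * x i)\<^sup>2"
        "l3 * (\<Sum>i<5. q 1 i * x i)\<^sup>2 \<le> l2 * (\<Sum>i<5. q 1 i * x i)\<^sup>2"
        using assms(1,2) by (auto intro!: mult_right_mono)
      then have "l3 * (\<Sum>i<5. (x i)\<^sup>2) \<le> (\<Sum>i<5. \<Sum>j<5. A $$ (i, j) * x i * x j)"
        unfolding norm[of x] form by (subst sums) (simp add: z distrib_left)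
      then show ?thesis unfolding scale using l3 by (simp add: pos_le_divide_eq mult.commute)
    qed
    show "(\<Sum>i<5. \<Sum>j<5. A $$ (i, j) / l3 * x i * x j) < 2 * (\<Sum>i<5. (x i)\<^sup>2)" if "\<exists>i<5. x i \<noteq> 0"
    proof -
      have "0 < (\<Sum>i<5. (x i)\<^sup>2)" using that by (auto intro: sum_pos2)
      then have "l1 * (\<Sum>i<5. (x i)\<^sup>2) < 2 * l3 * (\<Sum>i<5. (x i)\<^sup>2)"
        using assms(6) lt by (intro mult_strict_right_mono) auto
      then have "(\<Sum>i<5. \<Sum>j<5. A $$ (i, j) * x i * x j) < 2 * l3 * (\<Sum>i<5. (x i)\<^sup>2)"
        using upper[of x] by simp
      then show ?thesis unfolding scale using l3 by (simp add: pos_divide_less_eq mult_ac)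
    qed
  next
    fix u v :: real
    assume nn: "\<And>i. i < 5 \<Longrightarrow> 0 \<le> u * q 3 i + v * q 4 i"
    define y where "y i = u * q 3 i + v * q 4 i" for i
    have "(\<Sum>i<5. q j i * y i) = u * (\<Sum>i<5. q j i * q 3 i) + v * (\<Sum>i<5. q j i * q 4 i)" for j
      by (simp add: y_def sum_distrib_left sum.distrib algebra_simps)
    \<comment> \<open>On the span of the last two eigenvectors the form is negative definite,
      whereas a nonnegative matrix has a nonnegative form at a nonnegative vector.\<close>
    then have "(\<Sum>i<5. \<Sum>k<5. A $$ (i, k) * y i * y k) = l4 * u\<^sup>2 + l5 * v\<^sup>2"
      unfolding form by (simp add: orth)
    moreover have "0 \<le> (\<Sum>i<5. \<Sum>k<5. A $$ (i, k) * y i * y k)"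
      using nn nonneg by (intro sum_nonneg mult_nonneg_nonneg) (auto simp: y_def)
    moreover have "l4 * u\<^sup>2 \<le> 0" "l5 * v\<^sup>2 \<le> 0" using l4 l5 by (auto intro: mult_nonpos_nonneg)
    ultimately have "l4 * u\<^sup>2 = 0" "l5 * v\<^sup>2 = 0" by linarith+
    then show "u = 0 \<and> v = 0" using l4 l5 by simp
  qed
qed

end
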